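(* There exist absolute constants $C, c, c' > 0$ (not depending on $d$, $p$, $\boldsymbol{w}$, $\boldsymbol{b}$, $\boldsymbol{x}$ or $\varepsilon$) such that the following holds. Let $d \geq 1$, $p \in [1,\infty]$, and let $p' \in [1,\infty]$ satisfy $\frac{1}{p} + \frac{1}{p'} = 1$. Let $f(\boldsymbol{z}) = \boldsymbol{w}^T \boldsymbol{z} + \boldsymbol{b}$ be a binary linear classifier on $\mathbb{R}^d$ with $\boldsymbol{w} \in \mathbb{R}^d \setminus \{\boldsymbol{0}\}$, $\boldsymbol{b} \in \mathbb{R}$, and let $\boldsymbol{x} \in \mathbb{R}^d$ with $f(\boldsymbol{x}) \neq 0$. Then for every $0 < \varepsilon < \frac{c^2}{c'}$, \[ C\sqrt{\varepsilon}\, d^{1/p} \frac{\|\boldsymbol{w}\|_{p'}}{\|\boldsymbol{w}\|_2} \leq \frac{r_{p,\varepsilon}(\boldsymbol{x})}{\|\boldsymbol{r}^*_p(\boldsymbol{x})\|_p} \leq \frac{1}{\sqrt{c - \sqrt{c'\varepsilon}}}\, d^{1/p} \frac{\|\boldsymbol{w}\|_{p'}}{\|\boldsymbol{w}\|_2}. \]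
   Context: For the binary linear classifier $f(\boldsymbol{z}) = \boldsymbol{w}^T\boldsymbol{z} + \boldsymbol{b}$, the predicted label is $g(\boldsymbol{z}) = 1$ if $f(\boldsymbol{z}) > 0$ and $g(\boldsymbol{z}) = 0$ otherwise. For $p \in [1,\infty]$, $\mathcal{B}_p = \{\boldsymbol{z} \in \mathbb{R}^d : \|\boldsymbol{z}\|_p \leq 1\}$ is the unit $\ell_p$ ball, and $\boldsymbol{v}$ denotes a random vector uniformly distributed (w.r.t. Lebesgue measure) on $\mathcal{B}_p$. For $\varepsilon > 0$, $r_{p,\varepsilon}(\boldsymbol{x}) = \inf\{|\alpha| : \alpha \in \mathbb{R},\ \mathbb{P}_{\boldsymbol{v}}\{g(\boldsymbol{x} + \alpha\boldsymbol{v}) \neq g(\boldsymbol{x})\} \geq \varepsilon\}$, with the convention $\inf\emptyset = +\infty$. Also $\|\boldsymbol{r}^*_p(\boldsymbol{x})\|_p = \inf\{\|\boldsymbol{r}\|_p : g(\boldsymbol{x}+\boldsymbol{r}) \neq g(\boldsymbol{x})\}$, the $\ell_p$-distance from $\boldsymbol{x}$ to the decision boundary. Here $d^{1/\infty} = 1$. *)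

theory Defs
  imports "HOL-Probability.Probability"
begin

text \<open>Vectors in R^d are represented as functions nat => real; only the
coordinates i < d matter. The exponent p ranges over [1,infinity] as an ereal.\<close>

definition lp_norm :: "nat \<Rightarrow> ereal \<Rightarrow> (nat \<Rightarrow> real) \<Rightarrow> real" where
  "lp_norm d p z =
     (if p = \<infinity> then (if d = 0 then 0 else Max ((\<lambda>i. \<bar>z i\<bar>) ` {..<d}))
      else (\<Sum>i<d. \<bar>z i\<bar> powr real_of_ereal p) powr (1 / real_of_ereal p))"

definition lin_f :: "nat \<Rightarrow> (nat \<Rightarrow> real) \<Rightarrow> real \<Rightarrow> (nat \<Rightarrow> real) \<Rightarrow> real" where
  "lin_f d w b z = (\<Sum>i<d. w i * z i) + b"

text \<open>Predicted label: True stands for label 1, False for label 0.\<close>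
definition lin_g :: "nat \<Rightarrow> (nat \<Rightarrow> real) \<Rightarrow> real \<Rightarrow> (nat \<Rightarrow> real) \<Rightarrow> bool" where
  "lin_g d w b z = (lin_f d w b z > 0)"

definition leb :: "nat \<Rightarrow> (nat \<Rightarrow> real) measure" where
  "leb d = Pi\<^sub>M {..<d} (\<lambda>_. lborel)"

definition lp_ball :: "nat \<Rightarrow> ereal \<Rightarrow> (nat \<Rightarrow> real) set" where
  "lp_ball d p = {z \<in> space (leb d). lp_norm d p z \<le> 1}"

definition flip_prob :: "nat \<Rightarrow> ereal \<Rightarrow> (nat \<Rightarrow> real) \<Rightarrow> real \<Rightarrow> (nat \<Rightarrow> real) \<Rightarrow> real \<Rightarrow> real" where
  "flip_prob d p w b x \<alpha> =
     measure (uniform_measure (leb d) (lp_ball d p))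
       {v \<in> space (leb d). lin_g d w b (\<lambda>i. x i + \<alpha> * v i) \<noteq> lin_g d w b x}"

text \<open>r_{p,eps}(x); Inf of the empty set in ereal is +infinity.\<close>
definition r_eps :: "nat \<Rightarrow> ereal \<Rightarrow> (nat \<Rightarrow> real) \<Rightarrow> real \<Rightarrow> (nat \<Rightarrow> real) \<Rightarrow> real \<Rightarrow> ereal" where
  "r_eps d p w b x \<epsilon> = Inf {ereal \<bar>\<alpha>\<bar> | \<alpha>. flip_prob d p w b x \<alpha> \<ge> \<epsilon>}"

definition dist_boundary :: "nat \<Rightarrow> ereal \<Rightarrow> (nat \<Rightarrow> real) \<Rightarrow> real \<Rightarrow> (nat \<Rightarrow> real) \<Rightarrow> real" where
  "dist_boundary d p w b x =
     Inf {lp_norm d p r | r. lin_g d w b (\<lambda>i. x i + r i) \<noteq> lin_g d w b x}"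

end

theory Submission
  imports Defs
begin

text \<open>
Let \<open>V\<close> be uniform on the unit ball and \<open>Z = w \<bullet> V\<close>. The label flips at scale \<open>\<alpha>\<close> only if
\<open>\<bar>\<alpha>\<bar> \<bar>Z\<bar> \<ge> \<bar>f x\<bar>\<close>, and whenever this holds strictly, it flips at \<open>\<alpha>\<close> or at \<open>-\<alpha>\<close>. Hence the lower bound is
Chebyshev's inequality and the upper bound is a Paley--Zygmund inequality for \<open>Z\<close>; by Hoelder duality
the distance to the boundary is \<open>\<bar>f x\<bar>\<close> over the dual norm of \<open>w\<close>. Odd mixed moments of the
components vanish, so both inequalities reduce to showing that the second and fourth moments of a
component are of order $d^{-2/p}$ and $d^{-4/p}$ uniformly in \<open>p\<close>. For finite \<open>p\<close>, integration by parts in one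
coordinate yields $(p + n + d) \, E |V_i|^{n+p} = (n+1) \, E |V_i|^n$ for even \<open>n\<close>, and Jensen's
inequality relates the two sides. The upper bound only uses
$1 / \sqrt{c} \le 1 / \sqrt{c - \sqrt{c' \varepsilon}}$, the condition on \<open>\<epsilon>\<close> ensuring that it is below
a fixed flip probability.
\<close>

subsection \<open>Analytic preliminaries\<close>

lemma space_leb: "space (leb d) = PiE {..<d} (\<lambda>_. UNIV)"
  by (simp add: leb_def space_PiM)

lemma measurable_leb_component [measurable]: "i < d \<Longrightarrow> (\<lambda>v. v i) \<in> borel_measurable (leb d)"
  unfolding leb_def using measurable_component_singleton[of i "{..<d}" "\<lambda>_. lborel"] by simp

lemma emeasure_leb_box:
  assumes "\<And>i. i < d \<Longrightarrow> A i \<in> sets borel"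
  shows "emeasure (leb d) (PiE {..<d} A) = (\<Prod>i<d. emeasure lborel (A i))"
proof -
  interpret product_sigma_finite "\<lambda>_::nat. lborel :: real measure" ..
  show ?thesis unfolding leb_def by (rule emeasure_PiM) (use assms in auto)
qed

lemma mem_lp_ball_infinity:
  assumes "d \<ge> 1"
  shows "v \<in> lp_ball d \<infinity> \<longleftrightarrow> v \<in> space (leb d) \<and> (\<forall>i<d. \<bar>v i\<bar> \<le> 1)"
  using assms by (auto simp: lp_ball_def lp_norm_def lessThan_empty_iff)

lemma mem_lp_ball_ereal:
  assumes "P \<ge> 1"
  shows "v \<in> lp_ball d (ereal P) \<longleftrightarrow> v \<in> space (leb d) \<and> (\<Sum>i<d. \<bar>v i\<bar> powr P) \<le> 1"
proof -
  have "x powr (1 / P) \<le> 1 \<longleftrightarrow> x \<le> 1" if "x \<ge> 0" for x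
  proof
    assume "x powr (1 / P) \<le> 1"
    then have "(x powr (1 / P)) powr P \<le> 1 powr P" using assms by (intro powr_mono2) auto
    then show "x \<le> 1" using that assms by (simp add: powr_powr)
  next
    assume "x \<le> 1"
    then have "x powr (1 / P) \<le> 1 powr (1 / P)" using assms that by (intro powr_mono2) auto
    then show "x powr (1 / P) \<le> 1" by simp
  qed
  moreover have "(\<Sum>i<d. \<bar>v i\<bar> powr P) \<ge> 0" by (intro sum_nonneg) auto
  ultimately show ?thesis by (simp add: lp_ball_def lp_norm_def)
qed

section \<open>Convexity inequalities\<close>

text \<open>Young's inequality for the exponents \<open>r\<close> and \<open>r / (r - 1)\<close>.
  Multiplied by \<open>r\<close>, it says that the graph of \<open>y powr r\<close> lies above its
  tangent at \<open>m\<close>.\<close>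

lemma Youngs_tangent:
  fixes y m r :: real
  assumes "y \<ge> 0" "m \<ge> 0" "r > 1"
  shows "y * m powr (r - 1) \<le> y powr r / r + m powr r * (r - 1) / r"
proof -
  have "y * m powr (r - 1) \<le> y powr r / r + (m powr (r - 1)) powr (r / (r - 1)) / (r / (r - 1))"
    by (rule Youngs_inequality) (use assms in \<open>auto simp: field_simps\<close>)
  then show ?thesis using assms by (simp add: powr_powr)
qed

text \<open>Jensen's inequality, obtained by integrating the tangent inequality taken at the
  mean.\<close>

lemma (in prob_space) expectation_powr_mono:
  fixes Y :: "'a \<Rightarrow> real"
  assumes "\<And>\<omega>. Y \<omega> \<ge> 0" "r > 1" "integrable M Y" "integrable M (\<lambda>\<omega>. Y \<omega> powr r)"
  shows "expectation Y powr r \<le> expectation (\<lambda>\<omega>. Y \<omega> powr r)"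
proof -
  let ?m = "expectation Y"
  have m: "?m \<ge> 0" using assms by simp
  have "expectation (\<lambda>\<omega>. Y \<omega> * ?m powr (r - 1)) \<le>
      expectation (\<lambda>\<omega>. Y \<omega> powr r / r + ?m powr r * (r - 1) / r)"
    by (rule integral_mono) (use assms m Youngs_tangent in auto)
  also have "\<dots> = expectation (\<lambda>\<omega>. Y \<omega> powr r) / r + ?m powr r * (r - 1) / r"
    using assms by (simp add: prob_space)
  finally have "?m * ?m powr (r - 1) \<le> expectation (\<lambda>\<omega>. Y \<omega> powr r) / r + ?m powr r * (r - 1) / r"
    by simp
  moreover have "?m * ?m powr (r - 1) = ?m powr r" using m by (simp add: powr_mult_base)
  ultimately show ?thesis using assms(2) by (simp add: field_simps)
qed

text \<open>The tangent of \<open>y powr P\<close> at 1, evaluated at 2. It absorbs the summand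
  \<open>P\<close> of \<open>P + real d\<close> into a factor whose power \<open>2 / P\<close> is
  4.\<close>

lemma one_plus_le_two_powr:
  fixes P :: real
  assumes "P \<ge> 1"
  shows "1 + P \<le> 2 powr P"
proof (cases "P = 1")
  case False
  then have "2 \<le> 2 powr P / P + (P - 1) / P" using Youngs_tangent[of 2 1 P] assms by simp
  then have "2 * P \<le> 2 powr P + (P - 1)" using assms by (simp add: field_simps flip: add_divide_distrib)
  then show ?thesis by linarith
qed simp

section \<open>Derivatives and integrals along a line\<close>

lemma even_power_eq_powr:
  fixes x :: real
  assumes "even m" "m > 0"
  shows "x ^ m = \<bar>x\<bar> powr real m"
  using assms by (cases "x = 0") (simp_all add: powr_realpow power_even_abs)

text \<open>Away from 0 this is the product rule with \<open>sgn t\<close> as the derivative of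
  \<open>abs\<close>. At 0 the difference quotient is \<open>h ^ n * \<bar>h\<bar> powr P\<close>,
  which tends to 0, so one formula holds on the whole line.\<close>

lemma has_real_derivative_power_abs_powr:
  fixes t P :: real
  assumes "P \<ge> 1"
  shows "((\<lambda>t. t ^ Suc n * \<bar>t\<bar> powr P) has_real_derivative (real n + 1 + P) * (t ^ n * \<bar>t\<bar> powr P)) (at t)"
proof (cases "t = 0")
  case True
  have "((\<lambda>h. h ^ n * \<bar>h\<bar> powr P) \<longlongrightarrow> 0 ^ n * \<bar>0\<bar> powr P) (at (0::real))"
    using assms by (intro tendsto_intros tendsto_powr') auto
  then have "((\<lambda>h. h ^ n * \<bar>h\<bar> powr P) \<longlongrightarrow> 0) (at (0::real))" using assms by simp
  then have "((\<lambda>h. (h ^ Suc n * \<bar>h\<bar> powr P) / h) \<longlongrightarrow> 0) (at (0::real))"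
    by (rule Lim_transform_eventually) (auto simp: eventually_at_filter)
  then show ?thesis using True by (simp add: DERIV_def)
next
  case False
  have a: "(abs has_real_derivative sgn t) (at t)"
  proof (rule has_field_derivative_transform_within_open)
    show "((\<lambda>x. sgn t * x) has_real_derivative sgn t) (at t)"
      by (auto intro!: derivative_eq_intros)
    show "open (if t > 0 then {0<..} else {..<0::real})" by auto
    show "t \<in> (if t > 0 then {0<..} else {..<0})" using False by auto
  qed (use False in \<open>auto split: if_splits\<close>)
  have d: "((\<lambda>t. \<bar>t\<bar> powr P) has_real_derivative P * \<bar>t\<bar> powr (P - 1) * sgn t) (at t)"
    using DERIV_fun_powr[OF a, of P] False by simp
  have e: "t * (\<bar>t\<bar> powr (P - 1) * sgn t) = \<bar>t\<bar> powr P"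
    using False powr_mult_base[of "\<bar>t\<bar>" "P - 1"] by (auto simp: sgn_if abs_if split: if_splits)
  have "((\<lambda>t. t ^ Suc n * \<bar>t\<bar> powr P) has_real_derivative
     real (Suc n) * t ^ n * \<bar>t\<bar> powr P + P * \<bar>t\<bar> powr (P - 1) * sgn t * t ^ Suc n) (at t)"
    using DERIV_mult[OF DERIV_pow[of "Suc n" t] d] by (simp add: algebra_simps)
  also have "real (Suc n) * t ^ n * \<bar>t\<bar> powr P + P * \<bar>t\<bar> powr (P - 1) * sgn t * t ^ Suc n =
     (real n + 1) * (t ^ n * \<bar>t\<bar> powr P) + P * t ^ n * (t * (\<bar>t\<bar> powr (P - 1) * sgn t))"
    by (simp add: algebra_simps)
  finally show ?thesis unfolding e by (simp add: algebra_simps)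
qed

lemma integral_power_abs_powr_eq_0:
  fixes P s :: real
  assumes "P \<ge> 1" "s \<ge> 0"
  shows "(LINT t|lborel. ((real n + 1) * t ^ n * (s powr P - \<bar>t\<bar> powr P) - P * t ^ n * \<bar>t\<bar> powr P)
            * indicator {-s..s} t) = 0"
proof -
  have "(LINT t|lborel. ((real n + 1) * t ^ n * (s powr P - \<bar>t\<bar> powr P) - P * t ^ n * \<bar>t\<bar> powr P)
            * indicator {-s..s} t) = (s ^ Suc n * s powr P - s ^ Suc n * \<bar>s\<bar> powr P) -
        ((-s) ^ Suc n * s powr P - (-s) ^ Suc n * \<bar>-s\<bar> powr P)"
  proof (rule integral_FTC_Icc_real)
    show "-s \<le> s" using assms by simp
    fix t :: real
    show "((\<lambda>t. t ^ Suc n * s powr P - t ^ Suc n * \<bar>t\<bar> powr P) has_real_derivative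
      (real n + 1) * t ^ n * (s powr P - \<bar>t\<bar> powr P) - P * t ^ n * \<bar>t\<bar> powr P) (at t)"
      using DERIV_diff[OF DERIV_cmult_right[OF DERIV_pow[of "Suc n" t]]
          has_real_derivative_power_abs_powr[OF assms(1), of n t], of "s powr P"]
      by (simp add: algebra_simps)
    show "isCont (\<lambda>t. (real n + 1) * t ^ n * (s powr P - \<bar>t\<bar> powr P) - P * t ^ n * \<bar>t\<bar> powr P) t"
      using assms(1) unfolding isCont_def by (intro tendsto_intros tendsto_powr') auto
  qed
  then show ?thesis using assms(2) by simp
qed

text \<open>The reflection of the line preserves \<open>lborel\<close>. A non-integrable
  \<open>f\<close> is covered by the default value 0 of the integral.\<close>

lemma integral_odd_eq_0:
  fixes f :: "real \<Rightarrow> real"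
  assumes "\<And>t. f (- t) = - f t"
  shows "(LINT t|lborel. f t) = 0"
proof -
  have "(LINT t|lborel. f t) = (LINT t|lborel. f (- t))"
    using lborel_integral_real_affine[of "-1" f 0] by simp
  then show ?thesis by (simp add: assms)
qed

section \<open>Tail bounds from the second and the fourth moment\<close>

lemma (in prob_space) prob_abs_ge_second_moment:
  assumes "integrable M (\<lambda>\<omega>. Z \<omega> ^ 2)" "t > 0" and [measurable]: "Z \<in> borel_measurable M"
  shows "prob {\<omega> \<in> space M. \<bar>Z \<omega>\<bar> \<ge> t} \<le> expectation (\<lambda>\<omega>. Z \<omega> ^ 2) / t\<^sup>2"
proof -
  have "{\<omega> \<in> space M. \<bar>Z \<omega>\<bar> \<ge> t} = {\<omega> \<in> space M. t\<^sup>2 \<le> Z \<omega> ^ 2}"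
    using assms(2) abs_le_square_iff[of t] by auto
  then show ?thesis
    using integral_Markov_inequality_measure[OF assms(1), of "space M" "t\<^sup>2"] assms(2) by simp
qed

text \<open>A pointwise bound of \<open>Z \<omega> ^ 2\<close> is integrated: off the event it is at
  most \<open>\<mu>\<close>, and on the event the inequality between arithmetic and geometric mean
  trades it for the fourth power and a constant.\<close>

lemma (in prob_space) Paley_Zygmund:
  fixes Z :: "'a \<Rightarrow> real"
  assumes int: "integrable M (\<lambda>\<omega>. Z \<omega> ^ 2)" "integrable M (\<lambda>\<omega>. Z \<omega> ^ 4)"
    and [measurable]: "Z \<in> borel_measurable M"
    and pos: "\<mu> > 0" "K > 0"
    and second: "2 * \<mu> \<le> expectation (\<lambda>\<omega>. Z \<omega> ^ 2)"
    and fourth: "expectation (\<lambda>\<omega>. Z \<omega> ^ 4) \<le> K"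
  shows "\<mu>\<^sup>2 / K \<le> prob {\<omega> \<in> space M. \<mu> < Z \<omega> ^ 2}"
proof -
  let ?A = "{\<omega> \<in> space M. \<mu> < Z \<omega> ^ 2}"
  \<comment> \<open>With this weight the fourth moment contributes at most \<open>\<mu> / 2\<close>,
    so that \<open>\<mu> / 2\<close> of the second moment is left for the probability.\<close>
  define l where "l = \<mu> / K"
  have l: "l > 0" using pos by (simp add: l_def)
  have pointwise: "Z \<omega> ^ 2 \<le> \<mu> + l / 2 * Z \<omega> ^ 4 + 1 / (2 * l) * indicator ?A \<omega>" if "\<omega> \<in> space M" for \<omega>
  proof (cases "\<omega> \<in> ?A")
    case True
    have "0 \<le> (l * Z \<omega> ^ 2 - 1)\<^sup>2 / (2 * l)" using l by simp
    also have "\<dots> = l / 2 * Z \<omega> ^ 4 + 1 / (2 * l) - Z \<omega> ^ 2"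
      using l by (simp add: field_simps power2_eq_square power4_eq_xxxx)
    finally show ?thesis using True pos by simp
  next
    case False
    moreover have "0 \<le> l / 2 * Z \<omega> ^ 4" using l by simp
    ultimately show ?thesis using that by simp
  qed
  have ind: "integrable M (\<lambda>\<omega>. indicator ?A \<omega> :: real)" by (intro integrable_real_indicator) (auto simp: emeasure_eq_measure)
  have "2 * \<mu> \<le> expectation (\<lambda>\<omega>. \<mu> + l / 2 * Z \<omega> ^ 4 + 1 / (2 * l) * indicator ?A \<omega>)"
    by (rule order_trans[OF second integral_mono[OF int(1) _ pointwise]])
      (intro Bochner_Integration.integrable_add integrable_mult_right int ind integrable_const)
  also have "\<dots> = \<mu> + l / 2 * expectation (\<lambda>\<omega>. Z \<omega> ^ 4) + 1 / (2 * l) * prob ?A"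
    using int ind by (simp add: prob_space)
  also have "\<dots> \<le> \<mu> + l / 2 * K + 1 / (2 * l) * prob ?A"
    using fourth l by (intro add_mono mult_left_mono) auto
  also have "\<dots> = \<mu> + \<mu> / 2 + K / (2 * \<mu>) * prob ?A" using pos by (simp add: l_def)
  finally have "\<mu> / 2 \<le> K / (2 * \<mu>) * prob ?A" by linarith
  then show ?thesis using pos by (simp add: field_simps power2_eq_square)
qed

subsection \<open>The uniform distribution on the unit ball\<close>

locale unit_lp_ball =
  fixes d :: nat and p :: ereal
  assumes dim: "1 \<le> d" and exponent: "1 \<le> p"
begin

abbreviation B where "B \<equiv> lp_ball d p"
abbreviation U where "U \<equiv> uniform_measure (leb d) (lp_ball d p)"

lemma exponent_cases:
  obtains (infinity) "p = \<infinity>" | (finite) P where "p = ereal P" "P \<ge> 1"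
  using exponent by (cases p) (auto simp: one_ereal_def)

lemma sets_ball [measurable]: "B \<in> sets (leb d)"
proof (cases rule: exponent_cases)
  case infinity
  have "B = {v \<in> space (leb d). \<forall>i\<in>{..<d}. \<bar>v i\<bar> \<le> 1}"
    using mem_lp_ball_infinity[OF dim] infinity by auto
  also have "\<dots> \<in> sets (leb d)" by measurable
  finally show ?thesis .
next
  case (finite P)
  have "B = {v \<in> space (leb d). (\<Sum>i\<in>{..<d}. \<bar>v i\<bar> powr P) \<le> 1}"
    using mem_lp_ball_ereal finite by auto
  also have "\<dots> \<in> sets (leb d)" by measurable
  finally show ?thesis .
qed

lemma abs_component_le_1: "v \<in> B \<Longrightarrow> i < d \<Longrightarrow> \<bar>v i\<bar> \<le> 1"
proof (cases rule: exponent_cases)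
  case infinity
  assume "v \<in> B" "i < d"
  then show ?thesis using mem_lp_ball_infinity[OF dim] infinity by auto
next
  case (finite P)
  assume v: "v \<in> B" and i: "i < d"
  have "\<bar>v i\<bar> powr P \<le> (\<Sum>i<d. \<bar>v i\<bar> powr P)" using i by (intro member_le_sum) auto
  then have "\<bar>v i\<bar> powr P \<le> 1" using v finite mem_lp_ball_ereal by force
  then show ?thesis using powr_less_mono2[of P 1 "\<bar>v i\<bar>"] finite by (auto simp: not_le[symmetric])
qed

text \<open>The symmetry that makes odd moments vanish. Here \<open>y\<close> carries the
  coordinates other than \<open>i\<close>, as in the iterated integral.\<close>

lemma uminus_component_mem_ball:
  assumes "i < d" and y: "y \<in> PiE ({..<d} - {i}) (\<lambda>_. UNIV)"
  shows "y(i := - t) \<in> B \<longleftrightarrow> y(i := t) \<in> B"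
proof (cases rule: exponent_cases)
  case infinity
  then show ?thesis using mem_lp_ball_infinity[OF dim] assms by (auto simp: space_leb PiE_iff extensional_def)
next
  case (finite P)
  have "(\<Sum>j<d. \<bar>(y(i := - t)) j\<bar> powr P) = (\<Sum>j<d. \<bar>(y(i := t)) j\<bar> powr P)"
    by (intro sum.cong) auto
  then show ?thesis using mem_lp_ball_ereal finite assms by (auto simp: space_leb PiE_iff extensional_def)
qed

lemma emeasure_ball_finite: "emeasure (leb d) B < \<infinity>"
proof -
  have "emeasure (leb d) B \<le> emeasure (leb d) (PiE {..<d} (\<lambda>_. {-1..1}))"
  proof (rule emeasure_mono)
    show "B \<subseteq> PiE {..<d} (\<lambda>_. {-1..1})"
    proof
      fix v assume v: "v \<in> B"
      then have "v \<in> extensional {..<d}" by (simp add: lp_ball_def space_leb PiE_iff)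
      moreover have "v i \<in> {-1..1}" if "i < d" for i using abs_component_le_1[OF v that] by auto
      ultimately show "v \<in> PiE {..<d} (\<lambda>_. {-1..1})" by (simp add: PiE_iff)
    qed
    show "PiE {..<d} (\<lambda>_. {-1..1}) \<in> sets (leb d)" unfolding leb_def by (intro sets_PiM_I_finite) auto
  qed
  also have "\<dots> = ennreal (2 ^ d)" using emeasure_leb_box[of d "\<lambda>_. {-1..1}"] by (simp add: ennreal_power[symmetric])
  also have "\<dots> < \<infinity>" by simp
  finally show ?thesis .
qed

lemma emeasure_ball_pos: "0 < emeasure (leb d) B"
proof -
  \<comment> \<open>A cube of side \<open>1 / real d\<close> fits into the balls of all exponents:
    its coordinates are at most 1, so \<open>\<bar>v i\<bar> powr P\<close> is at most
    \<open>1 / real d\<close>.\<close>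
  have "0 < ennreal ((1 / real d) ^ d)" using dim by simp
  also have "\<dots> = emeasure (leb d) (PiE {..<d} (\<lambda>_. {0..1 / real d}))"
    using emeasure_leb_box[of d "\<lambda>_. {0..1 / real d}"] by (simp add: ennreal_power[symmetric])
  also have "\<dots> \<le> emeasure (leb d) B"
  proof (rule emeasure_mono)
    show "PiE {..<d} (\<lambda>_. {0..1 / real d}) \<subseteq> B"
    proof
      fix v :: "nat \<Rightarrow> real" assume v: "v \<in> PiE {..<d} (\<lambda>_. {0..1 / real d})"
      then have v0: "0 \<le> v i" "v i \<le> 1 / real d" if "i < d" for i using v that by (simp_all add: PiE_iff)
      have v1: "v i \<le> 1" if "i < d" for i
      proof -
        have "1 / real d \<le> 1" using dim by simp
        then show ?thesis using v0[OF that] by linarith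
      qed
      have sp: "v \<in> space (leb d)" unfolding space_leb by (rule PiE_I) (use v in \<open>auto simp only: PiE_iff extensional_def\<close>)
      show "v \<in> B"
      proof (cases rule: exponent_cases)
        case infinity
        then show ?thesis using v0(1) v1 sp by (simp add: mem_lp_ball_infinity[OF dim])
      next
        case (finite P)
        have "(\<Sum>i<d. \<bar>v i\<bar> powr P) \<le> (\<Sum>i<d. 1 / real d)"
        proof (rule sum_mono)
          fix i assume i: "i \<in> {..<d}"
          have "\<bar>v i\<bar> powr P \<le> \<bar>v i\<bar> powr 1" using v0[of i] v1[of i] i finite by (intro powr_mono') auto
          then show "\<bar>v i\<bar> powr P \<le> 1 / real d" using v0[of i] i by auto
        qed
        then show ?thesis using dim sp mem_lp_ball_ereal finite by auto
      qed
    qed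
  qed simp
  finally show ?thesis .
qed

section \<open>The uniform distribution and integration along an axis\<close>

sublocale U: prob_space U
  by (rule prob_space_uniform_measure) (use emeasure_ball_pos emeasure_ball_finite in auto)

lemma AE_ball: "AE v in U. v \<in> B"
  by (rule AE_uniform_measureI) auto

lemma integrable_bounded_on_ball:
  fixes F :: "(nat \<Rightarrow> real) \<Rightarrow> real"
  assumes "F \<in> borel_measurable (leb d)" "\<And>v. v \<in> B \<Longrightarrow> \<bar>F v\<bar> \<le> C"
  shows "integrable U F"
proof (rule U.integrable_const_bound)
  show "AE v in U. norm (F v) \<le> C" using AE_ball by eventually_elim (use assms in auto)
qed (use assms in simp)

text \<open>Fubini's theorem, integrating first along the axis \<open>i\<close>. Stating moment
  identities as vanishing expectations avoids computing the volume of the ball.\<close>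

lemma expectation_eq_0_if_slices:
  fixes F :: "(nat \<Rightarrow> real) \<Rightarrow> real"
  assumes i: "i < d"
    and F [measurable]: "F \<in> borel_measurable (leb d)" and bounded: "\<And>v. v \<in> B \<Longrightarrow> \<bar>F v\<bar> \<le> C"
    and slice: "\<And>y. y \<in> PiE ({..<d} - {i}) (\<lambda>_. UNIV) \<Longrightarrow>
      (LINT t|lborel. indicator B (y(i := t)) * F (y(i := t))) = 0"
  shows "U.expectation F = 0"
proof -
  interpret product_sigma_finite "\<lambda>_::nat. lborel :: real measure" ..
  have ins: "insert i ({..<d} - {i}) = {..<d}" using i by auto
  have int: "integrable (leb d) (\<lambda>v. indicator B v * F v)"
    using integrableI_bounded_set_indicator[of B "leb d" F C] bounded emeasure_ball_finite by simp
  have "(LINT v|leb d. indicator B v * F v) =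
    (LINT y|PiM ({..<d} - {i}) (\<lambda>_. lborel). LINT t|lborel. indicator B (y(i := t)) * F (y(i := t)))"
    using product_integral_insert[of "{..<d} - {i}" i "\<lambda>v. indicator B v * F v"] int
    unfolding ins leb_def by simp
  also have "\<dots> = (LINT y|PiM ({..<d} - {i}) (\<lambda>_. lborel :: real measure). 0)"
    by (rule Bochner_Integration.integral_cong[OF refl], rule slice) (simp add: space_PiM)
  finally have zero: "(LINT v|leb d. indicator B v * F v) = 0" by simp
  have m: "emeasure (leb d) B = ennreal (measure (leb d) B)" "0 < measure (leb d) B"
    using emeasure_ball_finite emeasure_ball_pos
    by (auto simp: measure_def enn2real_positive_iff less_top[symmetric])
  have "U = density (leb d) (\<lambda>v. ennreal (indicator B v / measure (leb d) B))"
    unfolding uniform_measure_def m(1) using m(2)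
    by (intro arg_cong[where f = "density (leb d)"] ext) (auto simp: indicator_def divide_ennreal[of 1, simplified])
  then have "U.expectation F = (LINT v|leb d. (indicator B v / measure (leb d) B) *\<^sub>R F v)"
    using m(2) by (simp add: integral_density)
  also have "\<dots> = (LINT v|leb d. indicator B v * F v) / measure (leb d) B"
    by simp
  finally show ?thesis using zero by simp
qed

text \<open>Reflecting the coordinate \<open>i\<close> preserves the ball and changes the sign of
  \<open>F\<close>, so every slice integrand is odd in \<open>t\<close>.\<close>

lemma expectation_odd_eq_0:
  fixes F :: "(nat \<Rightarrow> real) \<Rightarrow> real"
  assumes i: "i < d"
    and F: "F \<in> borel_measurable (leb d)" "\<And>v. v \<in> B \<Longrightarrow> \<bar>F v\<bar> \<le> C"
    and odd: "\<And>v t. F (v(i := - t)) = - F (v(i := t))"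
  shows "U.expectation F = 0"
proof (rule expectation_eq_0_if_slices[OF i F])
  fix y :: "nat \<Rightarrow> real" assume "y \<in> PiE ({..<d} - {i}) (\<lambda>_. UNIV)"
  then show "(LINT t|lborel. indicator B (y(i := t)) * F (y(i := t))) = 0"
    using uminus_component_mem_ball[OF i] odd by (intro integral_odd_eq_0) (auto simp: indicator_def)
qed

text \<open>On every line parallel to the \<open>i\<close>-th axis the difference of the two integrands is \<open>G\<close> times the
derivative of \<open>t ^ Suc n * (s powr P - \<bar>t\<bar> powr P)\<close>, which vanishes at both ends \<open>t = s\<close> and
\<open>t = - s\<close> of the section of the ball.\<close>

lemma expectation_component_recurrence:
  fixes G :: "(nat \<Rightarrow> real) \<Rightarrow> real"
  assumes P: "p = ereal P" "P \<ge> 1" and i: "i < d"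
    and [measurable]: "G \<in> borel_measurable (leb d)" and G: "\<And>v. v \<in> B \<Longrightarrow> \<bar>G v\<bar> \<le> 1"
    and G_upd: "\<And>v t. G (v(i := t)) = G v"
  shows "(real n + 1) * U.expectation (\<lambda>v. v i ^ n * G v * (1 - (\<Sum>j<d. \<bar>v j\<bar> powr P))) =
    P * U.expectation (\<lambda>v. v i ^ n * G v * \<bar>v i\<bar> powr P)"
proof -
  let ?N = "\<lambda>v::nat \<Rightarrow> real. \<Sum>j<d. \<bar>v j\<bar> powr P"
  let ?X = "\<lambda>v. v i ^ n * G v * (1 - ?N v)" and ?Y = "\<lambda>v. v i ^ n * G v * \<bar>v i\<bar> powr P"
  note [measurable] = i
  have N01: "0 \<le> ?N v" "?N v \<le> 1" if "v \<in> B" for v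
    using that mem_lp_ball_ereal P by (auto intro: sum_nonneg)
  have vG: "\<bar>v i ^ n * G v\<bar> \<le> 1" if "v \<in> B" for v
    using abs_component_le_1[OF that i] G[OF that] by (simp add: abs_mult power_abs mult_le_one power_le_one)
  have X: "\<bar>?X v\<bar> \<le> 1" if "v \<in> B" for v
    using vG[OF that] N01[OF that] unfolding abs_mult[of _ "1 - ?N v"] by (intro mult_le_one) auto
  have Y: "\<bar>?Y v\<bar> \<le> 1" if "v \<in> B" for v
    using vG[OF that] powr_le1[of P "\<bar>v i\<bar>"] abs_component_le_1[OF that i] P
    unfolding abs_mult[of _ "\<bar>v i\<bar> powr P"] by (intro mult_le_one) auto
  have meas: "?X \<in> borel_measurable (leb d)" "?Y \<in> borel_measurable (leb d)" by measurable
  have int: "integrable U ?X" "integrable U ?Y"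
    using integrable_bounded_on_ball[OF meas(1) X] integrable_bounded_on_ball[OF meas(2) Y] by auto
  have "U.expectation (\<lambda>v. (real n + 1) * ?X v - P * ?Y v) = 0"
  proof (rule expectation_eq_0_if_slices[OF i])
    show "(\<lambda>v. (real n + 1) * ?X v - P * ?Y v) \<in> borel_measurable (leb d)" by measurable
    show "\<bar>(real n + 1) * ?X v - P * ?Y v\<bar> \<le> real n + 1 + P" if "v \<in> B" for v
    proof -
      have "\<bar>(real n + 1) * ?X v\<bar> \<le> real n + 1" "\<bar>P * ?Y v\<bar> \<le> P"
        using X[OF that] Y[OF that] P by (simp_all add: abs_mult mult_left_le)
      then show ?thesis by linarith
    qed
    fix y :: "nat \<Rightarrow> real" assume y: "y \<in> PiE ({..<d} - {i}) (\<lambda>_. UNIV)"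
    let ?A = "\<Sum>j\<in>{..<d} - {i}. \<bar>y j\<bar> powr P"
    have N: "?N (y(i := t)) = ?A + \<bar>t\<bar> powr P" for t
      by (subst sum.remove[of _ i]) (use i in \<open>auto intro!: sum.cong\<close>)
    have N': "(\<Sum>j<d. \<bar>if j = i then t else y j\<bar> powr P) = ?A + \<bar>t\<bar> powr P" for t
      using N[of t] by (simp add: fun_upd_def)
    have mem: "y(i := t) \<in> B \<longleftrightarrow> ?A + \<bar>t\<bar> powr P \<le> 1" for t
      using y i mem_lp_ball_ereal[OF P(2), of "y(i := t)" d] P(1)
      unfolding N by (auto simp: space_leb PiE_iff extensional_def)
    show "(LINT t|lborel. indicator B (y(i := t)) * ((real n + 1) * ?X (y(i := t)) - P * ?Y (y(i := t)))) = 0"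
    proof (cases "?A \<le> 1")
      case False
      then have "y(i := t) \<notin> B" for t unfolding mem using powr_ge_zero[of "\<bar>t\<bar>" P] by linarith
      then show ?thesis by simp
    next
      case True
      \<comment> \<open>Half the length of the section: on this line \<open>1 - ?N\<close> becomes
        \<open>s powr P - \<bar>t\<bar> powr P\<close>, so membership in the ball means
        \<open>\<bar>t\<bar> \<le> s\<close>.\<close>
      define s where "s = (1 - ?A) powr (1 / P)"
      have s: "s \<ge> 0" "s powr P = 1 - ?A" using True P by (auto simp: s_def powr_powr)
      have mem': "y(i := t) \<in> B \<longleftrightarrow> t \<in> {-s..s}" for t
      proof -
        have "y(i := t) \<in> B \<longleftrightarrow> \<bar>t\<bar> powr P \<le> s powr P" unfolding mem s by auto
        also have "\<dots> \<longleftrightarrow> \<bar>t\<bar> \<le> s"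
          using powr_mono2[of P "\<bar>t\<bar>" s] powr_less_mono2[of P s "\<bar>t\<bar>"] s(1) P by force
        finally show ?thesis by auto
      qed
      have "(LINT t|lborel. indicator B (y(i := t)) * ((real n + 1) * ?X (y(i := t)) - P * ?Y (y(i := t)))) =
        (LINT t|lborel. G y * (((real n + 1) * t ^ n * (s powr P - \<bar>t\<bar> powr P) - P * t ^ n * \<bar>t\<bar> powr P)
            * indicator {-s..s} t))"
        by (intro Bochner_Integration.integral_cong refl)
          (auto simp: mem' indicator_def N' G_upd s algebra_simps)
      also have "\<dots> = 0" using integral_power_abs_powr_eq_0[OF P(2) s(1)] by simp
      finally show ?thesis .
    qed
  qed
  then show ?thesis using int by simp
qed

end

subsection \<open>Moments of a component\<close>

context unit_lp_ball
begin

text \<open>The factor d^(1/p). Since \<open>inverse \<infinity>\<close> is 0 in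
  \<open>ereal\<close>, infinite \<open>p\<close> is included.\<close>

definition \<kappa> :: real where "\<kappa> = real d powr real_of_ereal (inverse p)"

lemma prob_space_leb [simp]: "U.prob (space (leb d)) = 1"
  using U.prob_space by simp

lemma \<kappa>_pos: "\<kappa> > 0"
  using dim by (simp add: \<kappa>_def)

lemma \<kappa>_infinity: "p = \<infinity> \<Longrightarrow> \<kappa> = 1"
  using dim unfolding \<kappa>_def by simp

lemma integrable_component_power:
  assumes "i < d"
  shows "integrable U (\<lambda>v. v i ^ n)"
proof (rule integrable_bounded_on_ball)
  note [measurable] = assms
  show "(\<lambda>v. v i ^ n) \<in> borel_measurable (leb d)" by measurable
  show "\<bar>v i ^ n\<bar> \<le> 1" if "v \<in> B" for v
    using abs_component_le_1[OF that assms] by (simp add: power_abs power_le_one)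
qed

lemma integrable_component_power_powr:
  assumes "i < d" "j < d" "P \<ge> 0"
  shows "integrable U (\<lambda>v. v i ^ n * \<bar>v j\<bar> powr P)"
proof (rule integrable_bounded_on_ball)
  note [measurable] = assms
  show "(\<lambda>v. v i ^ n * \<bar>v j\<bar> powr P) \<in> borel_measurable (leb d)" by measurable
  show "\<bar>v i ^ n * \<bar>v j\<bar> powr P\<bar> \<le> 1" if "v \<in> B" for v
    using abs_component_le_1[OF that assms(1)] abs_component_le_1[OF that assms(2)] assms(3)
    by (simp add: abs_mult power_abs mult_le_one power_le_one powr_le1)
qed

lemma component_moment_recurrence:
  assumes P: "p = ereal P" "P \<ge> 1" and i: "i < d"
  shows "(P + real n + real d) * U.expectation (\<lambda>v. v i ^ n * \<bar>v i\<bar> powr P)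
    = (real n + 1) * U.expectation (\<lambda>v. v i ^ n)"
proof -
  define A where "A = U.expectation (\<lambda>v. v i ^ n * (1 - (\<Sum>j<d. \<bar>v j\<bar> powr P)))"
  note [measurable] = i
  \<comment> \<open>\<open>A\<close> expresses every summand of the expectation of \<open>v i ^ n * (\<Sum>j<d. \<bar>v j\<bar> powr P)\<close>:
    integrate along the axis \<open>j\<close>, treating \<open>v i ^ n\<close> as the constant factor unless \<open>j = i\<close>.\<close>
  have int: "integrable U (\<lambda>v. v i ^ n * \<bar>v j\<bar> powr P)" if "j < d" for j
    using integrable_component_power_powr i that P(2) by simp
  have self: "(real n + 1) * A = P * U.expectation (\<lambda>v. v i ^ n * \<bar>v i\<bar> powr P)"
    using expectation_component_recurrence[OF P i, of "\<lambda>_. 1" n] by (simp add: A_def)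
  have other: "A = P * U.expectation (\<lambda>v. v i ^ n * \<bar>v j\<bar> powr P)" if "j < d" "j \<noteq> i" for j
  proof -
    have "\<bar>v i ^ n\<bar> \<le> 1" if "v \<in> B" for v
      using abs_component_le_1[OF that i] by (simp add: power_abs power_le_one)
    then show ?thesis
      using expectation_component_recurrence[OF P \<open>j < d\<close>, of "\<lambda>v. v i ^ n" 0] \<open>j \<noteq> i\<close>
      by (simp add: A_def)
  qed
  have "A = U.expectation (\<lambda>v. v i ^ n - (\<Sum>j<d. v i ^ n * \<bar>v j\<bar> powr P))"
    unfolding A_def by (simp add: right_diff_distrib sum_distrib_left)
  also have "\<dots> = U.expectation (\<lambda>v. v i ^ n) - (\<Sum>j<d. U.expectation (\<lambda>v. v i ^ n * \<bar>v j\<bar> powr P))"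
    using int by (subst Bochner_Integration.integral_diff) (auto intro: integrable_component_power[OF i])
  finally have "P * U.expectation (\<lambda>v. v i ^ n) = P * A + (\<Sum>j<d. P * U.expectation (\<lambda>v. v i ^ n * \<bar>v j\<bar> powr P))"
    by (simp add: sum_distrib_left[symmetric] distrib_left[symmetric])
  also have "(\<Sum>j<d. P * U.expectation (\<lambda>v. v i ^ n * \<bar>v j\<bar> powr P)) =
      P * U.expectation (\<lambda>v. v i ^ n * \<bar>v i\<bar> powr P) +
      (\<Sum>j\<in>{..<d} - {i}. P * U.expectation (\<lambda>v. v i ^ n * \<bar>v j\<bar> powr P))"
    by (rule sum.remove) (use i in auto)
  also have "(\<Sum>j\<in>{..<d} - {i}. P * U.expectation (\<lambda>v. v i ^ n * \<bar>v j\<bar> powr P)) =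
      (\<Sum>j\<in>{..<d} - {i}. A)"
    by (rule sum.cong[OF refl], rule other[symmetric]) auto
  also have "\<dots> = (real d - 1) * A" using i by (simp add: of_nat_diff)
  also note self[symmetric]
  \<comment> \<open>The coefficient collects \<open>P\<close> from \<open>A\<close> itself,
    \<open>real n + 1\<close> from the axis \<open>i\<close> and 1 from each of the other
    \<open>d - 1\<close> axes.\<close>
  finally have "P * U.expectation (\<lambda>v. v i ^ n) = (P + real n + real d) * A" by (simp add: algebra_simps)
  then have "P * ((real n + 1) * U.expectation (\<lambda>v. v i ^ n)) = (P + real n + real d) * ((real n + 1) * A)"
    by simp
  also have "\<dots> = P * ((P + real n + real d) * U.expectation (\<lambda>v. v i ^ n * \<bar>v i\<bar> powr P))"
    unfolding self by simp
  finally show ?thesis using P(2) by simp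
qed

text \<open>Jensen turns the recurrence into a self-bounding inequality
\<open>e powr (1 + P / m) \<le> (m + 1) / d * e\<close> for the moment \<open>e\<close>.\<close>

lemma component_moment_upper:
  assumes i: "i < d" and m: "even m" "m > 0"
  shows "U.expectation (\<lambda>v. v i ^ m) \<le> (real m + 1) ^ m / \<kappa> ^ m"
proof (cases rule: exponent_cases)
  case infinity
  have "AE v in U. v i ^ m \<le> 1"
    using AE_ball by eventually_elim
      (metis abs_component_le_1 i abs_ge_zero power_le_one power_even_abs m(1))
  then have "U.expectation (\<lambda>v. v i ^ m) \<le> 1"
    using U.integral_le_const[OF integrable_component_power[OF i]] by simp
  also have "1 \<le> (real m + 1) ^ m" by (simp add: one_le_power)
  finally show ?thesis using \<kappa>_infinity[OF infinity] by simp
next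
  case (finite P)
  define e where "e = U.expectation (\<lambda>v. v i ^ m)"
  \<comment> \<open>Chosen so that \<open>(v i ^ m) powr r\<close> has order \<open>m + P\<close>,
    the order on the left of the recurrence.\<close>
  define r where "r = (P + real m) / real m"
  have r: "r > 1" "r - 1 = P / real m" using finite m(2) by (auto simp: r_def field_simps)
  have e0: "e \<ge> 0" unfolding e_def using m by (intro integral_nonneg_AE) (auto simp: zero_le_even_power)
  have powr_eq: "(x ^ m) powr r = x ^ m * \<bar>x\<bar> powr P" for x :: real
  proof -
    have "(x ^ m) powr r = \<bar>x\<bar> powr (real m + P)"
      using m unfolding even_power_eq_powr[OF m] by (simp add: powr_powr r_def add.commute)
    then show ?thesis by (simp add: powr_add even_power_eq_powr[OF m])
  qed
  have "e powr r \<le> U.expectation (\<lambda>v. (v i ^ m) powr r)"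
    unfolding e_def
  proof (rule U.expectation_powr_mono)
    show "integrable U (\<lambda>v. v i ^ m)" using i by (rule integrable_component_power)
    show "integrable U (\<lambda>v. (v i ^ m) powr r)"
      unfolding powr_eq using integrable_component_power_powr i finite(2) by simp
  qed (use r m in \<open>auto simp: zero_le_even_power\<close>)
  also have "\<dots> = (real m + 1) / (P + real m + real d) * e"
    using component_moment_recurrence[OF finite i, of m] finite(2)
    unfolding powr_eq e_def by (simp add: field_simps)
  also have "\<dots> \<le> (real m + 1) / real d * e"
    using finite(2) dim e0 by (intro mult_right_mono divide_left_mono) auto
  finally have er: "e powr r \<le> (real m + 1) / real d * e" .
  have \<kappa>m: "\<kappa> ^ m = real d powr (real m / P)"
    using dim finite unfolding \<kappa>_def by (simp add: powr_realpow[symmetric] powr_powr inverse_eq_divide)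
  show ?thesis
  proof (cases "e = 0")
    case True
    then show ?thesis using \<kappa>_pos by (simp add: e_def)
  next
    case False
    then have e: "e > 0" using e0 by simp
    have "e powr r = e * e powr (P / real m)"
      using e unfolding r(2)[symmetric] by (simp add: powr_mult_base)
    with er have "e * e powr (P / real m) \<le> e * ((real m + 1) / real d)" by (simp add: mult.commute)
    with e have "e powr (P / real m) \<le> (real m + 1) / real d" by (rule mult_left_le_imp_le[rotated])
    then have "(e powr (P / real m)) powr (real m / P) \<le> ((real m + 1) / real d) powr (real m / P)"
      using finite(2) by (intro powr_mono2) auto
    then have "e \<le> (real m + 1) powr (real m / P) / \<kappa> ^ m"
      using e finite(2) m dim \<kappa>m by (simp add: powr_powr powr_divide)
    \<comment> \<open>Since \<open>P \<ge> 1\<close>, this makes the constant uniform in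
      \<open>P\<close>.\<close>
    also have "(real m + 1) powr (real m / P) \<le> (real m + 1) powr real m"
      using finite(2) by (intro powr_mono) (auto simp: divide_le_eq mult_le_cancel_left1)
    also have "\<dots> = (real m + 1) ^ m" by (rule powr_realpow) simp
    finally show ?thesis using \<kappa>_pos by (simp add: e_def divide_right_mono)
  qed
qed

text \<open>Here the recurrence is used for the exponents 0 and 2: it gives the moment of order \<open>P\<close> exactly,
Jensen bounds the moment of order \<open>P + 2\<close> from below, and the recurrence leads back to the second
moment.\<close>

lemma component_second_moment_lower:
  assumes i: "i < d"
  shows "1 / (12 * \<kappa>\<^sup>2) \<le> U.expectation (\<lambda>v. (v i)\<^sup>2)"
proof (cases rule: exponent_cases)
  case infinity
  note [measurable] = i
  \<comment> \<open>\<open>1 / 3\<close> is the mean of the square on [-1, 1], and every nonempty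
    section of the cube is this interval.\<close>
  have "U.expectation (\<lambda>v. (v i)\<^sup>2 - 1 / 3) = 0"
  proof (rule expectation_eq_0_if_slices[OF i])
    show "(\<lambda>v. (v i)\<^sup>2 - 1 / 3) \<in> borel_measurable (leb d)" by measurable
    show "\<bar>(v i)\<^sup>2 - 1 / 3\<bar> \<le> 1" if "v \<in> B" for v
      using abs_component_le_1[OF that i] abs_square_le_1[of "v i"] zero_le_power2[of "v i"] by linarith
    fix y :: "nat \<Rightarrow> real" assume y: "y \<in> PiE ({..<d} - {i}) (\<lambda>_. UNIV)"
    have mem: "y(i := t) \<in> B \<longleftrightarrow> (\<forall>j\<in>{..<d} - {i}. \<bar>y j\<bar> \<le> 1) \<and> t \<in> {-1..1}" for t
      using y i mem_lp_ball_infinity[OF dim, of "y(i := t)"] infinity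
      by (auto simp: space_leb PiE_iff extensional_def split: if_splits)
    have "(LINT t|lborel. (t\<^sup>2 - 1 / 3) * indicator {-1..1} t) =
      (1 ^ 3 / 3 - 1 / 3) - ((-1) ^ 3 / 3 - (-1) / 3 :: real)"
      by (rule integral_FTC_Icc_real[where F = "\<lambda>t. t ^ 3 / 3 - t / 3"])
        (auto intro!: derivative_eq_intros continuous_intros)
    then have cube: "(LINT t|lborel. (t\<^sup>2 - 1 / 3) * indicator {-1..1} t) = (0::real)" by simp
    show "(LINT t|lborel. indicator B (y(i := t)) * (((y(i := t)) i)\<^sup>2 - 1 / 3)) = 0"
    proof (cases "\<forall>j\<in>{..<d} - {i}. \<bar>y j\<bar> \<le> 1")
      case True
      then have "(LINT t|lborel. indicator B (y(i := t)) * (((y(i := t)) i)\<^sup>2 - 1 / 3)) =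
          (LINT t|lborel. (t\<^sup>2 - 1 / 3) * indicator {-1..1} t)"
        by (intro Bochner_Integration.integral_cong refl) (auto simp: mem indicator_def)
      then show ?thesis using cube by simp
    next
      case False
      then have "y(i := t) \<notin> B" for t unfolding mem by blast
      then show ?thesis by simp
    qed
  qed
  then have "U.expectation (\<lambda>v. (v i)\<^sup>2) = 1 / 3"
    using integrable_component_power[OF i, of 2] by (simp add: U.prob_space)
  then show ?thesis using \<kappa>_infinity[OF infinity] by simp
next
  case (finite P)
  define a where "a = U.expectation (\<lambda>v. \<bar>v i\<bar> powr P)"
  define e where "e = U.expectation (\<lambda>v. (v i)\<^sup>2)"
  \<comment> \<open>Here \<open>P * r = P + 2\<close>, so Jensen leads from the moment of order
    \<open>P\<close> to the one in the recurrence for the exponent 2.\<close>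
  define r where "r = (P + 2) / P"
  have r: "r > 1" "r = 1 + 2 / P" using finite by (auto simp: r_def field_simps)
  have a: "a = 1 / (P + real d)"
    using component_moment_recurrence[OF finite i, of 0] finite(2) by (simp add: a_def field_simps U.prob_space)
  have powr_eq: "(\<bar>x\<bar> powr P) powr r = x\<^sup>2 * \<bar>x\<bar> powr P" for x :: real
  proof -
    have "(\<bar>x\<bar> powr P) powr r = \<bar>x\<bar> powr (2 + P)"
      using finite(2) by (simp add: powr_powr r_def add.commute)
    moreover have "\<bar>x\<bar> powr 2 = x\<^sup>2" using even_power_eq_powr[of 2 x] by simp
    ultimately show ?thesis by (simp only: powr_add)
  qed
  have "a powr r \<le> U.expectation (\<lambda>v. (\<bar>v i\<bar> powr P) powr r)"
    unfolding a_def
  proof (rule U.expectation_powr_mono)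
    show "integrable U (\<lambda>v. \<bar>v i\<bar> powr P)"
      using integrable_component_power_powr[OF i i, of P 0] finite(2) by simp
    show "integrable U (\<lambda>v. (\<bar>v i\<bar> powr P) powr r)"
      unfolding powr_eq using integrable_component_power_powr[OF i i, of P 2] finite(2) by simp
  qed (use r in auto)
  also have "\<dots> = 3 * e / (P + 2 + real d)"
    using component_moment_recurrence[OF finite i, of 2] finite(2)
    unfolding powr_eq e_def by (simp add: field_simps)
  finally have "a powr r * (P + 2 + real d) \<le> 3 * e" using finite(2) by (simp add: field_simps)
  \<comment> \<open>Lowering the factor to \<open>P + real d\<close>, the reciprocal of
    \<open>a\<close>, cancels one power of \<open>a\<close> and leaves
    \<open>a powr (2 / P)\<close>.\<close>
  moreover have "a powr r * (P + real d) \<le> a powr r * (P + 2 + real d)" by (intro mult_left_mono) auto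
  moreover have "a powr r * (P + real d) = a powr (2 / P)"
    using finite(2) unfolding r(2) powr_add by (simp add: a)
  moreover have "1 / (4 * \<kappa>\<^sup>2) \<le> a powr (2 / P)"
  proof -
    \<comment> \<open>This gives \<open>P + real d \<le> 2 powr P * real d\<close>, and the power
      \<open>2 / P\<close> of the right-hand side is \<open>4 * \<kappa>\<^sup>2\<close>. The factor
      3 of the recurrence then produces the 12.\<close>
    have P1: "1 + P \<le> 2 powr P" using finite(2) by (rule one_plus_le_two_powr)
    have "P + real d \<le> (1 + P) * real d" using finite(2) dim mult_left_mono[of 1 "real d" P] by (simp add: algebra_simps)
    also have "\<dots> \<le> 2 powr P * real d" using P1 by (intro mult_right_mono) auto
    finally have "(P + real d) powr (2 / P) \<le> (2 powr P * real d) powr (2 / P)"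
      using finite(2) by (intro powr_mono2) auto
    also have "\<dots> = 4 * \<kappa>\<^sup>2"
      using finite dim unfolding \<kappa>_def by (simp add: powr_mult powr_powr powr_realpow[symmetric] inverse_eq_divide)
    finally have "1 / (4 * \<kappa>\<^sup>2) \<le> 1 / (P + real d) powr (2 / P)"
      using finite(2) \<kappa>_pos by (intro divide_left_mono) auto
    then show ?thesis using finite(2) by (simp add: a powr_divide)
  qed
  ultimately have "1 / (4 * \<kappa>\<^sup>2) \<le> 3 * e" by linarith
  then show ?thesis by (simp add: e_def field_simps)
qed

end

subsection \<open>Moments of a linear form\<close>

context unit_lp_ball
begin

text \<open>The forms are truncated to the first \<open>k\<close> coordinates because their moments
  are computed by induction on \<open>k\<close>.\<close>

lemma linear_form_bound:
  assumes "v \<in> B" "k \<le> d"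
  shows "\<bar>\<Sum>i<k. w i * v i\<bar> \<le> (\<Sum>i<k. \<bar>w i\<bar>)"
proof -
  have "\<bar>\<Sum>i<k. w i * v i\<bar> \<le> (\<Sum>i<k. \<bar>w i * v i\<bar>)" by (rule sum_abs)
  also have "\<dots> \<le> (\<Sum>i<k. \<bar>w i\<bar>)"
    using assms by (intro sum_mono) (auto simp: abs_mult intro!: mult_left_le abs_component_le_1)
  finally show ?thesis .
qed

lemma measurable_linear_form [measurable]:
  assumes "k \<le> d"
  shows "(\<lambda>v. \<Sum>i<k. w i * v i) \<in> borel_measurable (leb d)"
  using assms by (intro borel_measurable_sum) auto

lemma linear_form_component_bound:
  assumes "v \<in> B" "k \<le> d" "i < d"
  shows "\<bar>(\<Sum>i<k. w i * v i) ^ m * v i ^ n\<bar> \<le> (\<Sum>i<k. \<bar>w i\<bar>) ^ m"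
proof -
  have "\<bar>(\<Sum>i<k. w i * v i) ^ m * v i ^ n\<bar> = \<bar>\<Sum>i<k. w i * v i\<bar> ^ m * \<bar>v i\<bar> ^ n"
    by (simp add: abs_mult power_abs)
  also have "\<dots> \<le> (\<Sum>i<k. \<bar>w i\<bar>) ^ m * 1"
    using linear_form_bound[OF assms(1,2)] abs_component_le_1[OF assms(1,3)]
    by (intro mult_mono power_mono power_le_one) (auto intro: sum_nonneg)
  finally show ?thesis by simp
qed

lemma integrable_linear_form_component:
  assumes "k \<le> d" "i < d"
  shows "integrable U (\<lambda>v. (\<Sum>i<k. w i * v i) ^ m * v i ^ n)"
proof (rule integrable_bounded_on_ball[OF _ linear_form_component_bound[OF _ assms]])
  note [measurable] = assms
  show "(\<lambda>v. (\<Sum>i<k. w i * v i) ^ m * v i ^ n) \<in> borel_measurable (leb d)" by measurable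
qed

lemma integrable_linear_form:
  assumes "k \<le> d"
  shows "integrable U (\<lambda>v. (\<Sum>i<k. w i * v i) ^ m)"
  using integrable_linear_form_component[OF assms, of 0 w m 0] dim by simp

text \<open>The truncated sum does not involve the coordinate \<open>k\<close>, so reflecting it
  only changes the sign of \<open>v k ^ n\<close>.\<close>

lemma linear_form_odd_eq_0:
  assumes "k < d" "odd n"
  shows "U.expectation (\<lambda>v. (\<Sum>i<k. w i * v i) ^ m * v k ^ n) = 0"
proof (rule expectation_odd_eq_0[OF assms(1) _ linear_form_component_bound[of _ k k w m n]])
  have [measurable]: "k \<le> d" "k < d" using assms by auto
  show "(\<lambda>v. (\<Sum>i<k. w i * v i) ^ m * v k ^ n) \<in> borel_measurable (leb d)" by measurable
  have s: "(\<Sum>i<k. w i * (v(k := t)) i) = (\<Sum>i<k. w i * v i)" for v :: "nat \<Rightarrow> real" and t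
    by (intro sum.cong) auto
  show "(\<Sum>i<k. w i * (v(k := - t)) i) ^ m * (v(k := - t)) k ^ n =
    - ((\<Sum>i<k. w i * (v(k := t)) i) ^ m * (v(k := t)) k ^ n)" for v t
    unfolding s using assms(2) by (simp add: power_minus_odd)
qed (use assms in auto)

text \<open>By symmetry distinct components are uncorrelated, so the mixed term disappears whenever
  a coordinate is added.\<close>

lemma linear_form_second_moment:
  assumes "k \<le> d"
  shows "U.expectation (\<lambda>v. (\<Sum>i<k. w i * v i)\<^sup>2) = (\<Sum>i<k. (w i)\<^sup>2 * U.expectation (\<lambda>v. (v i)\<^sup>2))"
  using assms
proof (induction k)
  case (Suc k)
  let ?S = "\<lambda>v. \<Sum>i<k. w i * v i"
  have k: "k \<le> d" "k < d" using Suc by auto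
  have "U.expectation (\<lambda>v. (\<Sum>i<Suc k. w i * v i)\<^sup>2) =
    U.expectation (\<lambda>v. (?S v)\<^sup>2 + 2 * w k * (?S v ^ 1 * v k ^ 1) + (w k)\<^sup>2 * (v k)\<^sup>2)"
    by (simp add: power2_sum power_mult_distrib algebra_simps)
  also have "\<dots> = U.expectation (\<lambda>v. (?S v)\<^sup>2) + 2 * w k * U.expectation (\<lambda>v. ?S v ^ 1 * v k ^ 1) +
      (w k)\<^sup>2 * U.expectation (\<lambda>v. (v k)\<^sup>2)"
    using integrable_linear_form[OF k(1), of w 2] integrable_component_power[OF k(2), of 2]
      integrable_linear_form_component[OF k, of w 1 1]
    by (subst Bochner_Integration.integral_add Bochner_Integration.integral_mult_right; simp)+
  also have "U.expectation (\<lambda>v. ?S v ^ 1 * v k ^ 1) = 0"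
    by (rule linear_form_odd_eq_0[OF k(2)]) simp
  finally show ?case using Suc k by simp
qed simp

text \<open>The constant 9 closes the induction: with \<open>W\<close> the sum of the squares so
  far, the only surviving mixed term is at most \<open>6 * (w k)\<^sup>2 * (3 * M * W)\<close>,
  which is exactly the mixed term of \<open>9 * M * (W + (w k)\<^sup>2)\<^sup>2\<close>.\<close>

lemma linear_form_fourth_moment:
  assumes "k \<le> d" and M: "\<And>i. i < d \<Longrightarrow> U.expectation (\<lambda>v. v i ^ 4) \<le> M"
  shows "U.expectation (\<lambda>v. (\<Sum>i<k. w i * v i) ^ 4) \<le> 9 * M * (\<Sum>i<k. (w i)\<^sup>2)\<^sup>2"
  using assms(1)
proof (induction k)
  case (Suc k)
  let ?S = "\<lambda>v. \<Sum>i<k. w i * v i" and ?W = "\<Sum>i<k. (w i)\<^sup>2"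
  have k: "k \<le> d" "k < d" using Suc by auto
  have M0: "M \<ge> 0" using M[OF k(2)] by (rule order_trans[rotated]) (simp add: integral_nonneg_AE)
  have W0: "?W \<ge> 0" by (intro sum_nonneg) auto
  have IH: "U.expectation (\<lambda>v. ?S v ^ 4) \<le> 9 * M * ?W\<^sup>2" using Suc k by simp
  have int: "integrable U (\<lambda>v. ?S v ^ m * v k ^ n)" for m n
    by (rule integrable_linear_form_component[OF k])
  have cross: "U.expectation (\<lambda>v. ?S v ^ 2 * v k ^ 2) \<le> 3 * M * ?W"
  proof (cases "?W = 0")
    case True
    then have "\<forall>i<k. w i = 0" by (simp add: sum_nonneg_eq_0_iff)
    then show ?thesis using True by simp
  next
    case False
    then have W: "?W > 0" using W0 by simp
    \<comment> \<open>The weights balance the bounds \<open>9 * M * ?W\<^sup>2\<close> and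
      \<open>M\<close> of the two fourth moments: each summand contributes
      \<open>3 * M * ?W / 2\<close>.\<close>
    have amgm: "s ^ 2 * t ^ 2 \<le> 1 / (6 * ?W) * s ^ 4 + 3 * ?W / 2 * t ^ 4" for s t :: real
    proof -
      have "0 \<le> (s\<^sup>2 - 3 * ?W * t\<^sup>2)\<^sup>2 / (6 * ?W)" using W by simp
      also have "\<dots> = 1 / (6 * ?W) * s ^ 4 + 3 * ?W / 2 * t ^ 4 - s ^ 2 * t ^ 2"
        using W by (simp add: field_simps power2_eq_square power4_eq_xxxx)
      finally show ?thesis by simp
    qed
    have "U.expectation (\<lambda>v. ?S v ^ 2 * v k ^ 2) \<le>
      U.expectation (\<lambda>v. 1 / (6 * ?W) * ?S v ^ 4 + 3 * ?W / 2 * v k ^ 4)"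
      using int[of 2 2] integrable_linear_form[OF k(1), of w 4] integrable_component_power[OF k(2), of 4] amgm
      by (intro integral_mono Bochner_Integration.integrable_add integrable_mult_right) auto
    also have "\<dots> = 1 / (6 * ?W) * U.expectation (\<lambda>v. ?S v ^ 4) + 3 * ?W / 2 * U.expectation (\<lambda>v. v k ^ 4)"
      using integrable_linear_form[OF k(1), of w 4] integrable_component_power[OF k(2), of 4] by simp
    also have "\<dots> \<le> 1 / (6 * ?W) * (9 * M * ?W\<^sup>2) + 3 * ?W / 2 * M"
      using IH M[OF k(2)] W by (intro add_mono mult_left_mono) auto
    also have "\<dots> = 3 * M * ?W" using W by (simp add: field_simps power2_eq_square)
    finally show ?thesis .
  qed
  have "U.expectation (\<lambda>v. (\<Sum>i<Suc k. w i * v i) ^ 4) =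
    U.expectation (\<lambda>v. ?S v ^ 4 + (4 * w k * (?S v ^ 3 * v k ^ 1) + (6 * (w k)\<^sup>2 * (?S v ^ 2 * v k ^ 2) +
      (4 * w k ^ 3 * (?S v ^ 1 * v k ^ 3) + w k ^ 4 * v k ^ 4))))"
  proof -
    have "(s + a * t) ^ 4 = s ^ 4 + (4 * a * (s ^ 3 * t ^ 1) + (6 * a\<^sup>2 * (s ^ 2 * t ^ 2) +
      (4 * a ^ 3 * (s ^ 1 * t ^ 3) + a ^ 4 * t ^ 4)))" for s a t :: real by algebra
    then show ?thesis by simp
  qed
  also have "\<dots> = U.expectation (\<lambda>v. ?S v ^ 4) + (4 * w k * U.expectation (\<lambda>v. ?S v ^ 3 * v k ^ 1) +
      (6 * (w k)\<^sup>2 * U.expectation (\<lambda>v. ?S v ^ 2 * v k ^ 2) +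
      (4 * w k ^ 3 * U.expectation (\<lambda>v. ?S v ^ 1 * v k ^ 3) + w k ^ 4 * U.expectation (\<lambda>v. v k ^ 4))))"
    using integrable_linear_form[OF k(1), of w 4] integrable_component_power[OF k(2), of 4]
      int[of 3 1] int[of 2 2] int[of 1 3]
    by (subst Bochner_Integration.integral_add Bochner_Integration.integral_mult_right; simp)+
  also have "U.expectation (\<lambda>v. ?S v ^ 3 * v k ^ 1) = 0"
    by (rule linear_form_odd_eq_0[OF k(2)]) simp
  also have "U.expectation (\<lambda>v. ?S v ^ 1 * v k ^ 3) = 0"
    by (rule linear_form_odd_eq_0[OF k(2)]) simp
  finally have "U.expectation (\<lambda>v. (\<Sum>i<Suc k. w i * v i) ^ 4) =
    U.expectation (\<lambda>v. ?S v ^ 4) + 6 * (w k)\<^sup>2 * U.expectation (\<lambda>v. ?S v ^ 2 * v k ^ 2) +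
      w k ^ 4 * U.expectation (\<lambda>v. v k ^ 4)" by simp
  also have "\<dots> \<le> 9 * M * ?W\<^sup>2 + 6 * (w k)\<^sup>2 * (3 * M * ?W) + w k ^ 4 * M"
    using IH cross M[OF k(2)] by (intro add_mono mult_left_mono) (auto simp: zero_le_even_power)
  also have "\<dots> \<le> 9 * M * (?W + (w k)\<^sup>2)\<^sup>2"
  proof -
    have "9 * M * (?W + (w k)\<^sup>2)\<^sup>2 - (9 * M * ?W\<^sup>2 + 6 * (w k)\<^sup>2 * (3 * M * ?W) + w k ^ 4 * M) = 8 * M * w k ^ 4"
      by algebra
    moreover have "0 \<le> 8 * M * w k ^ 4" using M0 by (simp add: zero_le_even_power)
    ultimately show ?thesis by linarith
  qed
  finally show ?case by simp
qed simp

text \<open>\<open>W\<close> is the squared Euclidean norm of \<open>w\<close>. The 9 in the first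
  bound is (2 + 1)^2 from the component bound; 5625 is (4 + 1)^4 times the 9 of the fourth-moment
  induction.\<close>

lemma linear_form_moments:
  fixes w :: "nat \<Rightarrow> real"
  defines "W \<equiv> \<Sum>i<d. (w i)\<^sup>2"
  shows "U.expectation (\<lambda>v. (\<Sum>i<d. w i * v i)\<^sup>2) \<le> 9 * (W / \<kappa>\<^sup>2)"
    and "W / \<kappa>\<^sup>2 / 12 \<le> U.expectation (\<lambda>v. (\<Sum>i<d. w i * v i)\<^sup>2)"
    and "U.expectation (\<lambda>v. (\<Sum>i<d. w i * v i) ^ 4) \<le> 5625 * (W / \<kappa>\<^sup>2)\<^sup>2"
proof -
  have "(\<Sum>i<d. (w i)\<^sup>2 * U.expectation (\<lambda>v. (v i)\<^sup>2)) \<le> (\<Sum>i<d. (w i)\<^sup>2 * (9 / \<kappa>\<^sup>2))"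
    using component_moment_upper[of _ 2] by (intro sum_mono mult_left_mono) auto
  then show "U.expectation (\<lambda>v. (\<Sum>i<d. w i * v i)\<^sup>2) \<le> 9 * (W / \<kappa>\<^sup>2)"
    unfolding linear_form_second_moment[OF order_refl] W_def by (subst (asm) sum_distrib_right[symmetric]) (simp add: mult.commute)
  have "(\<Sum>i<d. (w i)\<^sup>2 * (1 / (12 * \<kappa>\<^sup>2))) \<le> (\<Sum>i<d. (w i)\<^sup>2 * U.expectation (\<lambda>v. (v i)\<^sup>2))"
    using component_second_moment_lower by (intro sum_mono mult_left_mono) auto
  then show "W / \<kappa>\<^sup>2 / 12 \<le> U.expectation (\<lambda>v. (\<Sum>i<d. w i * v i)\<^sup>2)"
    unfolding linear_form_second_moment[OF order_refl] W_def by (simp add: sum_distrib_right[symmetric] sum_divide_distrib[symmetric])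
  have "U.expectation (\<lambda>v. (\<Sum>i<d. w i * v i) ^ 4) \<le> 9 * (625 / \<kappa> ^ 4) * (\<Sum>i<d. (w i)\<^sup>2)\<^sup>2"
    using component_moment_upper[of _ 4] by (intro linear_form_fourth_moment) auto
  also have "\<dots> = 5625 * (W / \<kappa>\<^sup>2)\<^sup>2" by (simp add: W_def power_divide)
  finally show "U.expectation (\<lambda>v. (\<Sum>i<d. w i * v i) ^ 4) \<le> 5625 * (W / \<kappa>\<^sup>2)\<^sup>2" .
qed

end

subsection \<open>Duality and the distance to the boundary\<close>

text \<open>After scaling both families to norm 1, Young's inequality is summed termwise; if one
  norm is 0, all products vanish.\<close>

lemma Holder_inequality_sum:
  fixes a b :: "'i \<Rightarrow> real"
  assumes "finite I" "P > 1" "Q > 1" "1 / P + 1 / Q = 1"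
  shows "(\<Sum>i\<in>I. \<bar>a i * b i\<bar>) \<le>
    (\<Sum>i\<in>I. \<bar>a i\<bar> powr P) powr (1 / P) * (\<Sum>i\<in>I. \<bar>b i\<bar> powr Q) powr (1 / Q)"
proof -
  define S T where "S = (\<Sum>i\<in>I. \<bar>a i\<bar> powr P)" and "T = (\<Sum>i\<in>I. \<bar>b i\<bar> powr Q)"
  have ST: "S \<ge> 0" "T \<ge> 0" unfolding S_def T_def by (auto intro: sum_nonneg)
  show ?thesis
  proof (cases "S = 0 \<or> T = 0")
    case True
    then have "\<forall>i\<in>I. a i * b i = 0"
      using assms(1) by (auto simp: S_def T_def sum_nonneg_eq_0_iff)
    then have "(\<Sum>i\<in>I. \<bar>a i * b i\<bar>) = 0" by (intro sum.neutral) auto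
    then show ?thesis by simp
  next
    case False
    then have pos: "S > 0" "T > 0" using ST by auto
    let ?s = "S powr (1 / P)" and ?t = "T powr (1 / Q)"
    have "(\<Sum>i\<in>I. \<bar>a i * b i\<bar>) / (?s * ?t) = (\<Sum>i\<in>I. (\<bar>a i\<bar> / ?s) * (\<bar>b i\<bar> / ?t))"
      by (simp add: sum_divide_distrib abs_mult)
    also have "\<dots> \<le> (\<Sum>i\<in>I. (\<bar>a i\<bar> / ?s) powr P / P + (\<bar>b i\<bar> / ?t) powr Q / Q)"
      using assms pos by (intro sum_mono Youngs_inequality) auto
    also have "\<dots> = (\<Sum>i\<in>I. \<bar>a i\<bar> powr P / S / P + \<bar>b i\<bar> powr Q / T / Q)"
      using assms pos by (simp add: powr_divide powr_powr)
    also have "\<dots> = 1 / P + 1 / Q"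
      using pos by (simp add: sum.distrib sum_divide_distrib[symmetric] S_def[symmetric] T_def[symmetric])
    finally have "(\<Sum>i\<in>I. \<bar>a i * b i\<bar>) / (?s * ?t) \<le> 1" using assms(4) by simp
    then show ?thesis using pos by (simp add: S_def T_def field_simps)
  qed
qed

lemma conjugate_exponent_cases:
  fixes p q :: ereal
  assumes "1 \<le> p" "1 \<le> q" "inverse p + inverse q = 1"
  obtains "p = 1" "q = \<infinity>" | "p = \<infinity>" "q = 1"
    | P Q where "p = ereal P" "q = ereal Q" "P > 1" "Q > 1" "1 / P + 1 / Q = 1"
proof (cases p)
  case (real P)
  note p = this
  show ?thesis
  proof (cases q)
    case (real Q)
    have PQ: "P \<ge> 1" "Q \<ge> 1" using assms p real by (auto simp: one_ereal_def)
    have e: "inverse P + inverse Q = 1"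
      using assms(3) PQ unfolding p real by (simp add: one_ereal_def)
    have "inverse P > 0" "inverse Q > 0" using PQ by auto
    then have "inverse P < 1" "inverse Q < 1" using e by linarith+
    then have "P > 1" "Q > 1" using PQ by (auto simp: inverse_less_1_iff)
    then show ?thesis using that(3) p real e by (simp add: inverse_eq_divide)
  next
    case PInf
    then show ?thesis using assms p that(1) by (auto simp: one_ereal_def split: if_splits)
  qed (use assms in auto)
next
  case PInf
  then show ?thesis using assms that(2) by (cases q) (auto simp: one_ereal_def split: if_splits)
qed (use assms in auto)

section \<open>The norms and their duality\<close>

lemma lp_norm_1: "lp_norm d 1 z = (\<Sum>i<d. \<bar>z i\<bar>)"
  by (simp add: lp_norm_def one_ereal_def sum_nonneg)

lemma lp_norm_infinity: "d \<ge> 1 \<Longrightarrow> lp_norm d \<infinity> z = Max ((\<lambda>i. \<bar>z i\<bar>) ` {..<d})"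
  by (simp add: lp_norm_def)

lemma lp_norm_ereal: "lp_norm d (ereal P) z = (\<Sum>i<d. \<bar>z i\<bar> powr P) powr (1 / P)"
  by (simp add: lp_norm_def)

lemma lp_norm_2: "lp_norm d 2 z = sqrt (\<Sum>i<d. (z i)\<^sup>2)"
proof -
  have "\<bar>z i\<bar> powr 2 = (z i)\<^sup>2" for i using even_power_eq_powr[of 2 "z i"] by simp
  then show ?thesis using lp_norm_ereal[of d 2 z] by (simp add: powr_half_sqrt sum_nonneg)
qed

lemma abs_le_lp_norm_infinity: "i < d \<Longrightarrow> \<bar>z i\<bar> \<le> lp_norm d \<infinity> z"
  by (subst lp_norm_infinity) auto

lemma lp_norm_cmult:
  assumes "d \<ge> 1" "1 \<le> p"
  shows "lp_norm d p (\<lambda>i. c * z i) = \<bar>c\<bar> * lp_norm d p z"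
proof (cases p)
  case (real P)
  then have P: "P \<ge> 1" using assms(2) by (simp add: one_ereal_def)
  have "(\<Sum>i<d. \<bar>c * z i\<bar> powr P) = \<bar>c\<bar> powr P * (\<Sum>i<d. \<bar>z i\<bar> powr P)"
    by (simp add: abs_mult powr_mult sum_distrib_left)
  then show ?thesis using P by (simp add: real lp_norm_ereal powr_mult powr_powr sum_nonneg)
next
  case PInf
  have "Max ((\<lambda>i. \<bar>c * z i\<bar>) ` {..<d}) = Max ((*) \<bar>c\<bar> ` (\<lambda>i. \<bar>z i\<bar>) ` {..<d})"
    by (simp add: abs_mult image_image)
  also have "\<dots> = \<bar>c\<bar> * Max ((\<lambda>i. \<bar>z i\<bar>) ` {..<d})"
    using assms(1) by (intro mono_Max_commute[symmetric]) (auto simp: mono_def mult_left_mono lessThan_empty_iff)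
  finally show ?thesis using PInf assms(1) by (simp add: lp_norm_infinity)
qed (use assms in auto)

lemma lp_norm_pos:
  assumes "1 \<le> p" "i < d" "w i \<noteq> 0"
  shows "0 < lp_norm d p w"
proof (cases p)
  case (real P)
  have "0 < (\<Sum>i<d. \<bar>w i\<bar> powr P)" using assms by (intro sum_pos2[of _ i]) auto
  then show ?thesis by (simp add: real lp_norm_ereal)
next
  case PInf
  have "0 < \<bar>w i\<bar>" using assms by simp
  also have "\<dots> \<le> lp_norm d p w" using PInf abs_le_lp_norm_infinity assms(2) by simp
  finally show ?thesis .
qed (use assms in auto)

lemma lp_norm_Holder:
  assumes "d \<ge> 1" "1 \<le> p" "1 \<le> q" "inverse p + inverse q = 1"
  shows "\<bar>\<Sum>i<d. w i * r i\<bar> \<le> lp_norm d q w * lp_norm d p r"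
proof -
  have H: "(\<Sum>i<d. \<bar>a i * b i\<bar>) \<le> lp_norm d \<infinity> a * lp_norm d 1 b" for a b
    unfolding lp_norm_1 sum_distrib_left
    by (intro sum_mono) (auto simp: abs_mult intro!: mult_right_mono abs_le_lp_norm_infinity)
  have "\<bar>\<Sum>i<d. w i * r i\<bar> \<le> (\<Sum>i<d. \<bar>w i * r i\<bar>)" by (rule sum_abs)
  also have "\<dots> \<le> lp_norm d q w * lp_norm d p r"
    using assms(2-4)
  proof (cases rule: conjugate_exponent_cases)
    case 1
    then show ?thesis using H[of w r] by simp
  next
    case 2
    then show ?thesis using H[of r w] by (simp add: mult.commute)
  next
    case (3 P Q)
    then show ?thesis using Holder_inequality_sum[of "{..<d}" Q P w r] by (simp add: lp_norm_ereal)
  qed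
  finally show ?thesis .
qed

text \<open>The extremal vectors: a signed unit vector at a coordinate of maximal modulus for
  \<open>p = 1\<close>, the sign vector for \<open>p = \<infinity>\<close>, and signed powers of the
  moduli otherwise. They point along a shortest way to the boundary.\<close>

lemma lp_norm_Holder_attained:
  assumes "d \<ge> 1" "1 \<le> p" "1 \<le> q" "inverse p + inverse q = 1" and w: "\<exists>i<d. w i \<noteq> 0"
  obtains u where "lp_norm d p u \<le> 1" "(\<Sum>i<d. w i * u i) = lp_norm d q w"
  using assms(2-4)
proof (cases rule: conjugate_exponent_cases)
  case 1
  have "lp_norm d q w \<in> (\<lambda>i. \<bar>w i\<bar>) ` {..<d}"
    using assms(1) 1 by (simp add: lp_norm_infinity) (intro Max_in, auto simp: lessThan_empty_iff)
  then obtain k where k: "k < d" "lp_norm d q w = \<bar>w k\<bar>" by auto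
  let ?u = "\<lambda>i. if i = k then sgn (w k) else 0"
  have "(\<Sum>i<d. \<bar>?u i\<bar>) = (\<Sum>i<d. if i = k then \<bar>sgn (w k)\<bar> else 0)" by (intro sum.cong) auto
  also have "\<dots> \<le> 1" using k by (simp add: abs_sgn_eq)
  finally have "lp_norm d p ?u \<le> 1" using 1 by (simp add: lp_norm_1)
  moreover have "(\<Sum>i<d. w i * ?u i) = (\<Sum>i<d. if i = k then \<bar>w k\<bar> else 0)"
    by (intro sum.cong) (auto simp: sgn_if)
  then have "(\<Sum>i<d. w i * ?u i) = lp_norm d q w" using k by simp
  ultimately show ?thesis by (rule that)
next
  case 2
  let ?u = "\<lambda>i. sgn (w i)"
  have "lp_norm d p ?u \<le> 1"
    using assms(1) 2 by (simp add: lp_norm_infinity) (auto simp: lessThan_empty_iff abs_sgn_eq)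
  moreover have "(\<Sum>i<d. w i * ?u i) = lp_norm d q w"
    using 2 by (simp add: lp_norm_1 abs_sgn[symmetric])
  ultimately show ?thesis by (rule that)
next
  case (3 P Q)
  define S where "S = (\<Sum>i<d. \<bar>w i\<bar> powr Q)"
  obtain k where "k < d" "w k \<noteq> 0" using w by blast
  then have S: "S > 0" unfolding S_def by (intro sum_pos2[of _ k]) auto
  have PQ: "(Q - 1) * P = Q" using 3 by (simp add: field_simps)
  \<comment> \<open>By \<open>PQ\<close> the sum of \<open>\<bar>u i\<bar> powr P\<close> is 1,
    while \<open>w i * u i\<close> is proportional to \<open>\<bar>w i\<bar> powr Q\<close>.\<close>
  define u where "u i = sgn (w i) * \<bar>w i\<bar> powr (Q - 1) / S powr (1 / P)" for i
  have "\<bar>u i\<bar> powr P = \<bar>w i\<bar> powr Q / S" for i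
  proof (cases "w i = 0")
    case False
    then have "\<bar>u i\<bar> = \<bar>w i\<bar> powr (Q - 1) / S powr (1 / P)" by (simp add: u_def abs_mult abs_sgn_eq)
    then show ?thesis using S 3 PQ by (simp add: powr_divide powr_powr)
  qed (simp add: u_def)
  then have "(\<Sum>i<d. \<bar>u i\<bar> powr P) = 1" using S by (simp add: sum_divide_distrib[symmetric] S_def[symmetric])
  then have "lp_norm d p u \<le> 1" using 3 by (simp add: lp_norm_ereal)
  moreover have "(\<Sum>i<d. w i * u i) = lp_norm d q w"
  proof -
    have "w i * u i = \<bar>w i\<bar> powr Q / S powr (1 / P)" for i
      using powr_mult_base[of "\<bar>w i\<bar>" "Q - 1"]
      by (simp add: u_def mult.assoc[symmetric] abs_sgn[symmetric])
    then have "(\<Sum>i<d. w i * u i) = S / S powr (1 / P)"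
      by (simp add: sum_divide_distrib[symmetric] S_def[symmetric])
    also have "\<dots> = S powr (1 - 1 / P)" using S by (simp add: powr_diff)
    also have "1 - 1 / P = 1 / Q" using 3 by simp
    finally show ?thesis using 3 by (simp add: lp_norm_ereal S_def)
  qed
  ultimately show ?thesis by (rule that)
qed

section \<open>The distance to the boundary\<close>

lemma lin_f_add: "lin_f d w b (\<lambda>i. x i + r i) = lin_f d w b x + (\<Sum>i<d. w i * r i)"
  by (simp add: lin_f_def distrib_left sum.distrib)

text \<open>A flip changes \<open>lin_f\<close> by at least its modulus at \<open>x\<close>, which
  Hoelder's inequality turns into a lower bound for the perturbation; the extremal vector shows that
  it is sharp.\<close>

lemma dist_boundary_eq:
  assumes "d \<ge> 1" "1 \<le> p" "1 \<le> q" "inverse p + inverse q = 1" and w: "\<exists>i<d. w i \<noteq> 0"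
    and f: "lin_f d w b x \<noteq> 0"
  shows "dist_boundary d p w b x = \<bar>lin_f d w b x\<bar> / lp_norm d q w"
proof -
  let ?f = "lin_f d w b x" and ?N = "lp_norm d q w"
  let ?S = "{lp_norm d p r | r. lin_g d w b (\<lambda>i. x i + r i) \<noteq> lin_g d w b x}"
  have N: "?N > 0" using w lp_norm_pos[OF assms(3)] by blast
  obtain u where u: "lp_norm d p u \<le> 1" "(\<Sum>i<d. w i * u i) = ?N"
    using lp_norm_Holder_attained[OF assms(1-5)] .
  have lower: "\<bar>?f\<bar> / ?N \<le> s" if s: "s \<in> ?S" for s
  proof -
    obtain r where r: "s = lp_norm d p r" "lin_g d w b (\<lambda>i. x i + r i) \<noteq> lin_g d w b x" using s by blast
    have "\<bar>?f\<bar> \<le> \<bar>\<Sum>i<d. w i * r i\<bar>" using r(2) unfolding lin_g_def lin_f_add by (auto simp: not_less)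
    also have "\<dots> \<le> ?N * s" unfolding r(1) by (rule lp_norm_Holder[OF assms(1-4)])
    finally show ?thesis using N by (simp add: field_simps)
  qed
  \<comment> \<open>Points with \<open>lin_f\<close> equal to 0 carry the label
    \<open>False\<close>, so for negative \<open>?f\<close> reaching the boundary does not flip. The
    perturbation overshoots by a factor \<open>e > 1\<close>, which later tends to 1.\<close>
  have mem: "\<exists>s\<in>?S. s \<le> e * (\<bar>?f\<bar> / ?N)" if e: "e > 1" for e
  proof -
    define c where "c = - (e * ?f / ?N)"
    have "(\<Sum>i<d. w i * (c * u i)) = c * (\<Sum>i<d. w i * u i)" by (simp add: sum_distrib_left mult.left_commute)
    also have "\<dots> = - (e * ?f)" using N by (simp add: u c_def)
    finally have "lin_f d w b (\<lambda>i. x i + c * u i) = (1 - e) * ?f"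
      by (simp add: lin_f_add algebra_simps)
    moreover have "(1 - e) * ?f > 0 \<longleftrightarrow> ?f < 0" using e by (simp add: zero_less_mult_iff)
    ultimately have "lin_g d w b (\<lambda>i. x i + c * u i) \<noteq> lin_g d w b x"
      using f by (auto simp: lin_g_def)
    moreover have "lp_norm d p (\<lambda>i. c * u i) \<le> e * (\<bar>?f\<bar> / ?N)"
    proof -
      have "lp_norm d p (\<lambda>i. c * u i) = \<bar>c\<bar> * lp_norm d p u" by (rule lp_norm_cmult[OF assms(1,2)])
      also have "\<dots> \<le> \<bar>c\<bar>" using u(1) by (simp add: mult_left_le)
      also have "\<dots> = e * (\<bar>?f\<bar> / ?N)" using e N by (simp add: c_def abs_mult)
      finally show ?thesis .
    qed
    ultimately show ?thesis by blast
  qed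
  have bdd: "bdd_below ?S" using lower by (rule bdd_belowI)
  have "Inf ?S \<le> \<bar>?f\<bar> / ?N"
  proof (rule field_le_mult_one_interval)
    fix z :: real assume z: "0 < z" "z < 1"
    obtain s where s: "s \<in> ?S" "s \<le> 1 / z * (\<bar>?f\<bar> / ?N)" using mem[of "1 / z"] z by auto
    have "Inf ?S \<le> s" using s(1) bdd by (rule cInf_lower)
    then have "z * Inf ?S \<le> z * (1 / z * (\<bar>?f\<bar> / ?N))" using s(2) z by (intro mult_left_mono) auto
    then show "z * Inf ?S \<le> \<bar>?f\<bar> / ?N" using z by simp
  qed
  \<comment> \<open>\<open>mem\<close> at 2 provides the nonemptiness required by
    \<open>cInf_greatest\<close>.\<close>
  moreover have "\<bar>?f\<bar> / ?N \<le> Inf ?S"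
    using mem[of 2] lower by (intro cInf_greatest) auto
  ultimately show ?thesis by (simp add: dist_boundary_def)
qed

subsection \<open>Flip probabilities\<close>

context unit_lp_ball
begin

lemma measurable_flip [measurable]:
  "{v \<in> space (leb d). lin_g d w b (\<lambda>i. x i + \<alpha> * v i) \<noteq> lin_g d w b x} \<in> sets (leb d)"
  unfolding lin_g_def lin_f_def by measurable

lemma lin_g_perturbed:
  "lin_g d w b (\<lambda>i. x i + \<alpha> * v i) \<longleftrightarrow> lin_f d w b x + \<alpha> * (\<Sum>i<d. w i * v i) > 0"
  by (simp add: lin_g_def lin_f_add sum_distrib_left mult.left_commute)

text \<open>Chebyshev's inequality for the linear form at the level of
  \<open>\<bar>lin_f d w b x\<bar> / \<bar>\<alpha>\<bar>\<close>; the 9 comes from its second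
  moment. At \<open>\<alpha> = 0\<close> nothing flips.\<close>

lemma flip_prob_le:
  assumes f: "lin_f d w b x \<noteq> 0"
  shows "flip_prob d p w b x \<alpha> \<le> 9 * (\<Sum>i<d. (w i)\<^sup>2) * \<alpha>\<^sup>2 / (\<kappa>\<^sup>2 * (lin_f d w b x)\<^sup>2)"
proof -
  let ?f = "lin_f d w b x" and ?Z = "\<lambda>v. \<Sum>i<d. w i * v i" and ?W = "\<Sum>i<d. (w i)\<^sup>2"
  let ?F = "{v \<in> space (leb d). lin_g d w b (\<lambda>i. x i + \<alpha> * v i) \<noteq> lin_g d w b x}"
  have flip: "\<bar>?f\<bar> \<le> \<bar>\<alpha>\<bar> * \<bar>?Z v\<bar>" if "v \<in> ?F" for v
  proof -
    have "(?f + \<alpha> * ?Z v > 0) \<noteq> (?f > 0)" using that by (simp add: lin_g_perturbed) (simp add: lin_g_def)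
    then have "\<bar>?f\<bar> \<le> \<bar>\<alpha> * ?Z v\<bar>" by linarith
    then show ?thesis by (simp add: abs_mult)
  qed
  show ?thesis
  proof (cases "\<alpha> = 0")
    case True
    then have "?F = {}" using flip f by fastforce
    then show ?thesis using True unfolding flip_prob_def by simp
  next
    case False
    have "flip_prob d p w b x \<alpha> \<le> U.prob {v \<in> space U. \<bar>?f\<bar> / \<bar>\<alpha>\<bar> \<le> \<bar>?Z v\<bar>}"
      unfolding flip_prob_def
    proof (rule U.finite_measure_mono)
      show "?F \<subseteq> {v \<in> space U. \<bar>?f\<bar> / \<bar>\<alpha>\<bar> \<le> \<bar>?Z v\<bar>}"
        using flip False by (auto simp: divide_le_eq mult.commute)
      show "{v \<in> space U. \<bar>?f\<bar> / \<bar>\<alpha>\<bar> \<le> \<bar>?Z v\<bar>} \<in> sets U"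
        unfolding sets_uniform_measure space_uniform_measure by measurable
    qed
    also have "\<dots> \<le> U.expectation (\<lambda>v. (?Z v)\<^sup>2) / (\<bar>?f\<bar> / \<bar>\<alpha>\<bar>)\<^sup>2"
      by (rule U.prob_abs_ge_second_moment) (use integrable_linear_form f False in auto)
    also have "\<dots> \<le> 9 * (?W / \<kappa>\<^sup>2) / (\<bar>?f\<bar> / \<bar>\<alpha>\<bar>)\<^sup>2"
      by (intro divide_right_mono linear_form_moments) auto
    also have "\<dots> = 9 * ?W * \<alpha>\<^sup>2 / (\<kappa>\<^sup>2 * ?f\<^sup>2)" by (simp add: power_divide)
    finally show ?thesis .
  qed
qed

lemma flip_prob_ge:
  assumes w: "\<exists>i<d. w i \<noteq> 0" and f: "lin_f d w b x \<noteq> 0"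
    and \<alpha>: "\<alpha>\<^sup>2 = 24 * \<kappa>\<^sup>2 * (lin_f d w b x)\<^sup>2 / (\<Sum>i<d. (w i)\<^sup>2)"
  shows "\<exists>\<beta>. \<bar>\<beta>\<bar> = \<bar>\<alpha>\<bar> \<and> 1 / 6480000 \<le> flip_prob d p w b x \<beta>"
proof -
  let ?f = "lin_f d w b x" and ?Z = "\<lambda>v. \<Sum>i<d. w i * v i" and ?W = "\<Sum>i<d. (w i)\<^sup>2"
  let ?F = "\<lambda>\<beta>. {v \<in> space (leb d). lin_g d w b (\<lambda>i. x i + \<beta> * v i) \<noteq> lin_g d w b x}"
  \<comment> \<open>Half of the lower bound for the second moment. The prescribed
    \<open>\<alpha>\<close> satisfies \<open>\<alpha>\<^sup>2 * \<mu> = ?f\<^sup>2\<close>, and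
    Paley-Zygmund yields the reciprocal of 24^2 * 5625 = 3240000.\<close>
  define \<mu> where "\<mu> = ?W / \<kappa>\<^sup>2 / 24"
  obtain k where "k < d" "w k \<noteq> 0" using w by blast
  then have W: "?W > 0" by (intro sum_pos2[of _ k]) auto
  have \<kappa>: "\<kappa> > 0" by (rule \<kappa>_pos)
  have \<alpha>\<mu>: "\<alpha>\<^sup>2 * \<mu> = ?f\<^sup>2" using W \<kappa> by (simp add: \<alpha> \<mu>_def)
  have "\<alpha> \<noteq> 0" using \<alpha>\<mu> f by auto
  have "1 / 3240000 = \<mu>\<^sup>2 / (5625 * (?W / \<kappa>\<^sup>2)\<^sup>2)" using W \<kappa> by (simp add: \<mu>_def power_divide)
  also have "\<dots> \<le> U.prob {v \<in> space U. \<mu> < (?Z v)\<^sup>2}"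
  proof (rule U.Paley_Zygmund)
    show "2 * \<mu> \<le> U.expectation (\<lambda>v. (?Z v)\<^sup>2)"
      using linear_form_moments(2)[of w] by (simp add: \<mu>_def)
  qed (use integrable_linear_form linear_form_moments(3) W \<kappa> in \<open>auto simp: \<mu>_def\<close>)
  also have "\<dots> \<le> U.prob (?F \<alpha> \<union> ?F (- \<alpha>))"
  proof (rule U.finite_measure_mono)
    show "?F \<alpha> \<union> ?F (- \<alpha>) \<in> sets U" unfolding sets_uniform_measure by measurable
    show "{v \<in> space U. \<mu> < (?Z v)\<^sup>2} \<subseteq> ?F \<alpha> \<union> ?F (- \<alpha>)"
    proof
      fix v assume v: "v \<in> {v \<in> space U. \<mu> < (?Z v)\<^sup>2}"
      then have "\<alpha>\<^sup>2 * \<mu> < \<alpha>\<^sup>2 * (?Z v)\<^sup>2" using \<open>\<alpha> \<noteq> 0\<close> by (intro mult_strict_left_mono) auto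
      then have "?f\<^sup>2 < (\<alpha> * ?Z v)\<^sup>2" by (simp add: \<alpha>\<mu> power_mult_distrib)
      then have "\<bar>?f\<bar> < \<bar>\<alpha> * ?Z v\<bar>"
        unfolding not_le[symmetric] abs_le_square_iff .
      \<comment> \<open>The two perturbed values have opposite nonzero signs, so one of them has
        another label than \<open>x\<close>.\<close>
      then have "(?f + \<alpha> * ?Z v > 0) \<noteq> (?f > 0) \<or> (?f + - \<alpha> * ?Z v > 0) \<noteq> (?f > 0)"
        using f unfolding mult_minus_left by linarith
      then show "v \<in> ?F \<alpha> \<union> ?F (- \<alpha>)"
        using v unfolding lin_g_perturbed by (auto simp: lin_g_def)
    qed
  qed
  \<comment> \<open>One of the two signs carries at least half of the probability; either will do,
    since \<open>r_eps\<close> records \<open>\<bar>\<alpha>\<bar>\<close>.\<close>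
  also have "\<dots> \<le> U.prob (?F \<alpha>) + U.prob (?F (- \<alpha>))"
    by (rule measure_Un_le) (simp_all only: sets_uniform_measure measurable_flip)
  finally have "1 / 6480000 \<le> flip_prob d p w b x \<alpha> \<or> 1 / 6480000 \<le> flip_prob d p w b x (- \<alpha>)"
    unfolding flip_prob_def by linarith
  then show ?thesis by (metis abs_minus)
qed

end

theorem theorem1:
  shows "\<exists>C c c' :: real. C > 0 \<and> c > 0 \<and> c' > 0 \<and>
    (\<forall>(d::nat) (p::ereal) (p'::ereal) (w::nat \<Rightarrow> real) (b::real) (x::nat \<Rightarrow> real) (\<epsilon>::real).
       d \<ge> 1 \<longrightarrow> 1 \<le> p \<longrightarrow> 1 \<le> p' \<longrightarrow> inverse p + inverse p' = 1 \<longrightarrow>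
       (\<exists>i<d. w i \<noteq> 0) \<longrightarrow> lin_f d w b x \<noteq> 0 \<longrightarrow>
       0 < \<epsilon> \<longrightarrow> \<epsilon> < c\<^sup>2 / c' \<longrightarrow>
       ereal (C * sqrt \<epsilon> * real d powr real_of_ereal (inverse p) * lp_norm d p' w / lp_norm d 2 w)
         \<le> r_eps d p w b x \<epsilon> / ereal (dist_boundary d p w b x)
       \<and> r_eps d p w b x \<epsilon> / ereal (dist_boundary d p w b x)
         \<le> ereal (1 / sqrt (c - sqrt (c' * \<epsilon>)) * real d powr real_of_ereal (inverse p)
                   * lp_norm d p' w / lp_norm d 2 w))"
\<comment> \<open>\<open>1 / 3\<close> is the inverse root of the 9 in \<open>flip_prob_le\<close>,
  and \<open>1 / 24\<close> matches the scale in \<open>flip_prob_ge\<close>. The value 11250 makes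
  \<open>c\<^sup>2 / c'\<close> equal to \<open>1 / 6480000\<close>, the flip probability guaranteed
  there.\<close>
proof (rule exI[of _ "1 / 3"], rule exI[of _ "1 / 24"], rule exI[of _ 11250], intro conjI allI impI)
  fix d :: nat and p p' :: ereal and w x :: "nat \<Rightarrow> real" and b \<epsilon> :: real
  assume d: "d \<ge> 1" and p: "1 \<le> p" "1 \<le> p'" "inverse p + inverse p' = 1"
    and w: "\<exists>i<d. w i \<noteq> 0" and f0: "lin_f d w b x \<noteq> 0"
    and \<epsilon>: "0 < \<epsilon>" "\<epsilon> < (1 / 24)\<^sup>2 / 11250"
  interpret unit_lp_ball d p by standard (use d p in auto)
  define f where "f = \<bar>lin_f d w b x\<bar>"
  define N where "N = lp_norm d p' w"
  define n where "n = lp_norm d 2 w"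
  let ?D = "dist_boundary d p w b x" and ?R = "r_eps d p w b x \<epsilon>"
  have N: "N > 0" using w lp_norm_pos[OF p(2)] unfolding N_def by blast
  have n2: "n\<^sup>2 = (\<Sum>i<d. (w i)\<^sup>2)" unfolding n_def lp_norm_2 by (simp add: sum_nonneg)
  have n: "n > 0" using w lp_norm_pos[of 2] unfolding n_def by (auto simp: one_ereal_def)
  have f: "f > 0" "f\<^sup>2 = (lin_f d w b x)\<^sup>2" using f0 by (auto simp: f_def)
  have D: "?D = f / N" using dist_boundary_eq[OF d p w f0] by (simp add: f_def N_def)
  have D0: "?D > 0" using f N by (simp add: D)
  have \<kappa>: "\<kappa> > 0" by (rule \<kappa>_pos)
  have "ereal (?D * (1 / 3 * sqrt \<epsilon> * \<kappa> * N / n)) \<le> ?R"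
    unfolding r_eps_def
  proof (rule Inf_greatest, clarify)
    fix \<alpha> assume "\<epsilon> \<le> flip_prob d p w b x \<alpha>"
    also have "\<dots> \<le> 9 * n\<^sup>2 * \<alpha>\<^sup>2 / (\<kappa>\<^sup>2 * f\<^sup>2)" unfolding n2 f(2) using f0 by (rule flip_prob_le)
    also have "\<dots> = (3 * n * \<bar>\<alpha>\<bar> / (\<kappa> * f))\<^sup>2" by (simp add: power_divide power_mult_distrib)
    finally have "sqrt \<epsilon> \<le> 3 * n * \<bar>\<alpha>\<bar> / (\<kappa> * f)" using n \<kappa> f by (intro real_le_lsqrt) auto
    then show "ereal (?D * (1 / 3 * sqrt \<epsilon> * \<kappa> * N / n)) \<le> ereal \<bar>\<alpha>\<bar>"
      using n \<kappa> f N by (simp add: D field_simps)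
  qed
  then show "ereal (1 / 3 * sqrt \<epsilon> * real d powr real_of_ereal (inverse p) * lp_norm d p' w / lp_norm d 2 w)
      \<le> ?R / ereal ?D"
    using D0 by (subst ereal_le_divide_pos) (simp_all add: \<kappa>_def N_def n_def)
  define \<alpha> where "\<alpha> = sqrt 24 * \<kappa> * f / n"
  have "\<alpha>\<^sup>2 = 24 * \<kappa>\<^sup>2 * (lin_f d w b x)\<^sup>2 / (\<Sum>i<d. (w i)\<^sup>2)"
    by (simp add: \<alpha>_def power_divide power_mult_distrib f(2) n2)
  from flip_prob_ge[OF w f0 this] obtain \<beta> where
    \<beta>: "\<bar>\<beta>\<bar> = \<bar>\<alpha>\<bar>" "1 / 6480000 \<le> flip_prob d p w b x \<beta>" by blast
  have "\<epsilon> \<le> flip_prob d p w b x \<beta>" using \<beta>(2) \<epsilon>(2) by (simp add: power2_eq_square)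
  then have "?R \<le> ereal \<bar>\<beta>\<bar>" unfolding r_eps_def by (intro Inf_lower) blast
  also have "\<bar>\<beta>\<bar> = sqrt 24 * \<kappa> * f / n" using \<beta>(1) \<kappa> f n by (simp add: \<alpha>_def)
  also have "\<dots> \<le> 1 / sqrt (1 / 24 - sqrt (11250 * \<epsilon>)) * \<kappa> * f / n"
  proof -
    \<comment> \<open>The bound on \<epsilon> keeps the difference under the root positive, where
      the real division and \<open>sqrt\<close> have their usual meaning.\<close>
    have "sqrt (11250 * \<epsilon>) < sqrt ((1 / 24)\<^sup>2)" using \<epsilon> by (intro real_sqrt_less_mono) simp
    then have pos: "0 < 1 / 24 - sqrt (11250 * \<epsilon>)" by simp
    have "sqrt 24 = 1 / sqrt (1 / 24)" by (simp add: real_sqrt_divide)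
    also have "\<dots> \<le> 1 / sqrt (1 / 24 - sqrt (11250 * \<epsilon>))"
      using pos \<epsilon> by (intro divide_left_mono mult_pos_pos) auto
    finally show ?thesis using \<kappa> f n by (intro divide_right_mono mult_right_mono) auto
  qed
  also have "\<dots> = ?D * (1 / sqrt (1 / 24 - sqrt (11250 * \<epsilon>)) * \<kappa> * N / n)" using N by (simp add: D)
  finally have "?R \<le> ereal (?D * (1 / sqrt (1 / 24 - sqrt (11250 * \<epsilon>)) * \<kappa> * N / n))" by simp
  then show "?R / ereal ?D \<le> ereal (1 / sqrt (1 / 24 - sqrt (11250 * \<epsilon>)) * real d powr real_of_ereal (inverse p)
      * lp_norm d p' w / lp_norm d 2 w)"
    using D0 by (subst ereal_divide_le_pos) (simp_all add: \<kappa>_def N_def n_def)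
qed simp_all

end
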